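(* The bilinear form $b(\cdot,\cdot)$ is coercive and continuous in $H_N(\mathrm{div};\Omega)\times H^1_D(\Omega)$; i.e., there exist positive constants $\alpha$ and $C$, depending on bounds of the coefficients $A$, $\mathbf b$, $a$ (and possibly on the domain $\Omega$), such that $$\alpha\,|\!|\!|(\boldsymbol\tau,v)|\!|\!|^2\le b(\boldsymbol\tau,v;\boldsymbol\tau,v)$$ and $$b(\boldsymbol\eta,w;\boldsymbol\tau,v)\le C\,|\!|\!|(\boldsymbol\eta,w)|\!|\!|\;|\!|\!|(\boldsymbol\tau,v)|\!|\!|$$ for all $(\boldsymbol\eta,w),(\boldsymbol\tau,v)\in H_N(\mathrm{div};\Omega)\times H^1_D(\Omega)$.
   Context: $\Omega\subset\mathbb R^d$ ($d=2$ or $3$) is a bounded, open, connected set with Lipschitz continuous boundary and outward unit normal $\mathbf n$. $\partial\Omega=\bar\Gamma_D\cup\bar\Gamma_N$ with $\Gamma_D,\Gamma_N$ open and disjoint, $\Gamma_D$ of positive measure and connected. $(\cdot,\cdot)$ and $\|\cdot\|$ are the $L^2(\Omega)$ inner product and norm. Coefficients: $A$ is a $d\times d$ symmetric matrix-valued function with $\Lambda_0\boldsymbol\xi^T\boldsymbol\xi\le\boldsymbol\xi^TA(x)\boldsymbol\xi\le\Lambda_1\boldsymbol\xi^T\boldsymbol\xi$ for all $\boldsymbol\xi\in\mathbb R^d$ and almost all $x\in\overline\Omega$, where $0<\Lambda_0\le\Lambda_1$ are constants; $\mathbf b\in L^\infty(\Omega)^d$; $a\in L^\infty(\Omega)$ is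 a scalar function with $a\neq0$. Spaces: $H^1_D(\Omega)=\{v\in H^1(\Omega): v=0 \text{ on }\Gamma_D\}$; $H_N(\mathrm{div};\Omega)=\{\boldsymbol\tau\in L^2(\Omega)^d:\nabla\cdot\boldsymbol\tau\in L^2(\Omega),\ \mathbf n\cdot\boldsymbol\tau=0\text{ on }\Gamma_N\}$. Standing assumption: for every $f\in L^2(\Omega)$ the problem of finding $u\in H^1_D(\Omega)$ with $(A\nabla u,\nabla v)+(\mathbf b\cdot\nabla u+au,v)=(f,v)$ for all $v\in H^1_D(\Omega)$, and the dual problem of finding $z\in H^1_D(\Omega)$ with $(\nabla\phi,(A\nabla+\mathbf b)z)+(\phi,az)=(f,\phi)$ for all $\phi\in H^1_D(\Omega)$, have unique solutions, which satisfy $\|u\|_{H^2(\Omega)}\le C\|f\|$ and $\|z\|_{H^2(\Omega)}\le C\|f\|$. Here $(A\nabla+\mathbf b)v:=A\nabla v+\mathbf b\,v$, and similarly for related expressions. Bilinear form: $$b(\boldsymbol\eta,w;\boldsymbol\tau,v)=\big(\boldsymbol\eta-(A\nabla+\mathbf b)w,\;A^{-1}\boldsymbol\tau-(\nabla+A^{-1}\mathbf b)v\big)+\big(a^{-1}\nabla\cdot\boldsymbol\eta-w,\;\nabla\cdot\boldsymbol\tau-a\,v\big).$$ Norm: $|\!|\!|(\boldsymbol\tau,v)|\!|\!|^2=\|a^{1/2}v\|^2+\|A^{1/2}\nabla v\|^2+\|A^{-1/2}\boldsymbol\tau\|^2+\|a^{-1/2}\nabla\cdot\boldsymbol\tau\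|^2$.
   Formalization: The condition a≠0 is read as 0<a0≤a≤a1 a.e. (for negative a the root a^{1/2} is undefined and coercivity fails; for unbounded 1/a the form is not finite), and the constants may also depend on the constant C of the standing H² regularity estimate. *)

theory Defs
  imports "HOL-Analysis.Analysis"
begin

text \<open>
  Functions on a domain \<open>\<Omega>\<close> are represented by total functions on \<^typ>\<open>real^'n\<close>; only their values
  on \<open>\<Omega>\<close>, up to null sets, are relevant.
\<close>

section \<open>Square-integrable functions\<close>

definition L2 :: "(real^'n) set \<Rightarrow> (real^'n \<Rightarrow> 'b::euclidean_space) set" where
  "L2 \<Omega> = {f \<in> borel_measurable (lebesgue_on \<Omega>). integrable (lebesgue_on \<Omega>) (\<lambda>x. (norm (f x))\<^sup>2)}"

definition L2_inner ::
    "(real^'n) set \<Rightarrow> (real^'n \<Rightarrow> 'b::euclidean_space) \<Rightarrow> (real^'n \<Rightarrow> 'b) \<Rightarrow> real" where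
  "L2_inner \<Omega> f g = (LINT x|lebesgue_on \<Omega>. f x \<bullet> g x)"

definition L2_norm :: "(real^'n) set \<Rightarrow> (real^'n \<Rightarrow> 'b::euclidean_space) \<Rightarrow> real" where
  "L2_norm \<Omega> f = sqrt (LINT x|lebesgue_on \<Omega>. (norm (f x))\<^sup>2)"

section \<open>Smooth functions and weak derivatives\<close>

primrec Ck_function :: "nat \<Rightarrow> (real^'n \<Rightarrow> real) \<Rightarrow> bool" where
  "Ck_function 0 f \<longleftrightarrow> continuous_on UNIV f"
| "Ck_function (Suc k) f \<longleftrightarrow>
     f differentiable_on UNIV \<and> (\<forall>e\<in>Basis. Ck_function k (\<lambda>x. frechet_derivative f (at x) e))"

definition smooth_function :: "(real^'n \<Rightarrow> real) \<Rightarrow> bool" where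
  "smooth_function f \<longleftrightarrow> (\<forall>k. Ck_function k f)"

definition test_functions :: "(real^'n) set \<Rightarrow> (real^'n \<Rightarrow> real) set" where
  "test_functions \<Omega> =
     {\<phi>. smooth_function \<phi> \<and> compact (closure {x. \<phi> x \<noteq> 0}) \<and> closure {x. \<phi> x \<noteq> 0} \<subseteq> \<Omega>}"

definition classical_grad :: "(real^'n \<Rightarrow> real) \<Rightarrow> real^'n \<Rightarrow> real^'n" where
  "classical_grad \<phi> x = (\<chi> i. frechet_derivative \<phi> (at x) (axis i 1))"

definition has_weak_grad ::
    "(real^'n) set \<Rightarrow> (real^'n \<Rightarrow> real) \<Rightarrow> (real^'n \<Rightarrow> real^'n) \<Rightarrow> bool" where
  "has_weak_grad \<Omega> u G \<longleftrightarrow> u \<in> L2 \<Omega> \<and> G \<in> L2 \<Omega> \<and>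
     (\<forall>\<phi>\<in>test_functions \<Omega>. \<forall>i.
        (LINT x|lebesgue_on \<Omega>. u x * (classical_grad \<phi> x $ i)) =
        - (LINT x|lebesgue_on \<Omega>. (G x $ i) * \<phi> x))"

definition has_weak_div ::
    "(real^'n) set \<Rightarrow> (real^'n \<Rightarrow> real^'n) \<Rightarrow> (real^'n \<Rightarrow> real) \<Rightarrow> bool" where
  "has_weak_div \<Omega> \<tau> D \<longleftrightarrow> \<tau> \<in> L2 \<Omega> \<and> D \<in> L2 \<Omega> \<and>
     (\<forall>\<phi>\<in>test_functions \<Omega>.
        (LINT x|lebesgue_on \<Omega>. \<tau> x \<bullet> classical_grad \<phi> x) = - (LINT x|lebesgue_on \<Omega>. D x * \<phi> x))"

text \<open>
  For open \<open>\<Omega>\<close>, weak gradients and divergences are unique almost everywhere on \<open>\<Omega>\<close>, so the choices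
  below only fix representatives.
\<close>

definition weak_grad :: "(real^'n) set \<Rightarrow> (real^'n \<Rightarrow> real) \<Rightarrow> real^'n \<Rightarrow> real^'n" where
  "weak_grad \<Omega> u = (SOME G. has_weak_grad \<Omega> u G)"

definition weak_div :: "(real^'n) set \<Rightarrow> (real^'n \<Rightarrow> real^'n) \<Rightarrow> real^'n \<Rightarrow> real" where
  "weak_div \<Omega> \<tau> = (SOME D. has_weak_div \<Omega> \<tau> D)"

section \<open>Sobolev spaces\<close>

definition H1 :: "(real^'n) set \<Rightarrow> (real^'n \<Rightarrow> real) set" where
  "H1 \<Omega> = {u. \<exists>G. has_weak_grad \<Omega> u G}"

definition H1_norm :: "(real^'n) set \<Rightarrow> (real^'n \<Rightarrow> real) \<Rightarrow> real" where
  "H1_norm \<Omega> u = sqrt ((L2_norm \<Omega> u)\<^sup>2 + (L2_norm \<Omega> (weak_grad \<Omega> u))\<^sup>2)"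

definition H2 :: "(real^'n) set \<Rightarrow> (real^'n \<Rightarrow> real) set" where
  "H2 \<Omega> = {u \<in> H1 \<Omega>. \<forall>i. (\<lambda>x. weak_grad \<Omega> u x $ i) \<in> H1 \<Omega>}"

definition H2_norm :: "(real^'n) set \<Rightarrow> (real^'n \<Rightarrow> real) \<Rightarrow> real" where
  "H2_norm \<Omega> u = sqrt ((L2_norm \<Omega> u)\<^sup>2 + (L2_norm \<Omega> (weak_grad \<Omega> u))\<^sup>2 +
     (\<Sum>i\<in>UNIV. (L2_norm \<Omega> (weak_grad \<Omega> (\<lambda>x. weak_grad \<Omega> u x $ i)))\<^sup>2))"

definition Hdiv :: "(real^'n) set \<Rightarrow> (real^'n \<Rightarrow> real^'n) set" where
  "Hdiv \<Omega> = {\<tau>. \<exists>D. has_weak_div \<Omega> \<tau> D}"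

section \<open>Boundary, traces and boundary conditions\<close>

text \<open>Locally, after a choice of the vertical direction \<open>e\<close>, the domain is the part of a ball above
  the graph of a Lipschitz function on the hyperplane orthogonal to \<open>e\<close>.\<close>

definition Lipschitz_boundary :: "(real^'n) set \<Rightarrow> bool" where
  "Lipschitz_boundary \<Omega> \<longleftrightarrow>
     (\<forall>p\<in>frontier \<Omega>. \<exists>r>0. \<exists>e. \<exists>g :: real^'n \<Rightarrow> real. \<exists>L.
        norm e = 1 \<and> L-lipschitz_on {z. z \<bullet> e = 0} g \<and>
        \<Omega> \<inter> ball p r = {x \<in> ball p r. g (x - (x \<bullet> e) *\<^sub>R e) < x \<bullet> e})"

text \<open>
  The \<open>s\<close>-dimensional Hausdorff measure (\<open>s \<ge> 1\<close>), normalised to agree with Lebesgue measure on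
  \<open>s\<close>-dimensional planes. The outer measure is a metric outer measure, hence countably additive on
  the Borel sets, so \<^const>\<open>measure_of\<close> takes its values there.
\<close>

definition hausdorff_outer :: "nat \<Rightarrow> (real^'n) set \<Rightarrow> ennreal" where
  "hausdorff_outer s S =
     (SUP \<delta>\<in>{0<..}. INF C\<in>{C :: nat \<Rightarrow> (real^'n) set.
          S \<subseteq> (\<Union>k. C k) \<and> (\<forall>k. bounded (C k) \<and> diameter (C k) \<le> \<delta>)}.
        (\<Sum>k. ennreal (unit_ball_vol (real s) * (diameter (C k) / 2) ^ s)))"

definition hausdorff_measure :: "nat \<Rightarrow> (real^'n) measure" where
  "hausdorff_measure s = measure_of UNIV (sets borel) (hausdorff_outer s)"

definition surface_measure :: "(real^'n) set \<Rightarrow> (real^'n) measure" where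
  "surface_measure \<Omega> = restrict_space (hausdorff_measure (CARD('n) - 1)) (frontier \<Omega>)"

text \<open>
  The trace operator of \<open>H\<^sup>1(\<Omega>)\<close> is the continuous extension, with values in \<open>L\<^sup>2(\<partial>\<Omega>)\<close>, of the
  restriction to the boundary of functions that are smooth up to the boundary.
\<close>

definition has_trace :: "(real^'n) set \<Rightarrow> (real^'n \<Rightarrow> real) \<Rightarrow> (real^'n \<Rightarrow> real) \<Rightarrow> bool" where
  "has_trace \<Omega> u g \<longleftrightarrow> u \<in> H1 \<Omega> \<and> g \<in> borel_measurable (surface_measure \<Omega>) \<and>
     (\<exists>\<phi>. (\<forall>k. smooth_function (\<phi> k)) \<and>
        (\<lambda>k. H1_norm \<Omega> (\<lambda>x. \<phi> k x - u x)) \<longlonglongrightarrow> 0 \<and>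
        (\<lambda>k. \<integral>\<^sup>+x. ennreal ((\<phi> (k::nat) x - g x)\<^sup>2) \<partial>surface_measure \<Omega>) \<longlonglongrightarrow> 0)"

definition H1_D :: "(real^'n) set \<Rightarrow> (real^'n) set \<Rightarrow> (real^'n \<Rightarrow> real) set" where
  "H1_D \<Omega> \<Gamma>\<^sub>D =
     {v \<in> H1 \<Omega>. \<exists>g. has_trace \<Omega> v g \<and> (AE x in surface_measure \<Omega>. x \<in> \<Gamma>\<^sub>D \<longrightarrow> g x = 0)}"

text \<open>
  The normal component of a field in \<open>H(div;\<Omega>)\<close> on the boundary is the functional on traces given
  by Green's formula. It vanishes on \<open>\<Gamma>\<^sub>N\<close>, the part of the boundary complementary to
  \<open>\<Gamma>\<^sub>D\<close>, if it annihilates the functions whose trace vanishes on \<open>\<Gamma>\<^sub>D\<close>.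
\<close>

definition normal_trace :: "(real^'n) set \<Rightarrow> (real^'n \<Rightarrow> real^'n) \<Rightarrow> (real^'n \<Rightarrow> real) \<Rightarrow> real" where
  "normal_trace \<Omega> \<tau> \<phi> = L2_inner \<Omega> \<tau> (weak_grad \<Omega> \<phi>) + L2_inner \<Omega> (weak_div \<Omega> \<tau>) \<phi>"

definition H_N_div :: "(real^'n) set \<Rightarrow> (real^'n) set \<Rightarrow> (real^'n \<Rightarrow> real^'n) set" where
  "H_N_div \<Omega> \<Gamma>\<^sub>D = {\<tau> \<in> Hdiv \<Omega>. \<forall>\<phi>\<in>H1_D \<Omega> \<Gamma>\<^sub>D. normal_trace \<Omega> \<tau> \<phi> = 0}"

definition admissible_domain :: "(real^'n) set \<Rightarrow> (real^'n) set \<Rightarrow> (real^'n) set \<Rightarrow> bool" where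
  "admissible_domain \<Omega> \<Gamma>\<^sub>D \<Gamma>\<^sub>N \<longleftrightarrow>
     open \<Omega> \<and> bounded \<Omega> \<and> connected \<Omega> \<and> Lipschitz_boundary \<Omega> \<and>
     frontier \<Omega> = closure \<Gamma>\<^sub>D \<union> closure \<Gamma>\<^sub>N \<and> \<Gamma>\<^sub>D \<inter> \<Gamma>\<^sub>N = {} \<and>
     openin (top_of_set (frontier \<Omega>)) \<Gamma>\<^sub>D \<and> openin (top_of_set (frontier \<Omega>)) \<Gamma>\<^sub>N \<and>
     emeasure (surface_measure \<Omega>) \<Gamma>\<^sub>D > 0 \<and> connected \<Gamma>\<^sub>D"

section \<open>Coefficients and the boundary value problems\<close>

text \<open>
  The coefficient \<open>a\<close> is bounded away from zero and positive: this is what the expressions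
  \<open>a\<^sup>1\<^sup>/\<^sup>2\<close>, \<open>a\<^sup>-\<^sup>1\<close> and \<open>a\<^sup>-\<^sup>1\<^sup>/\<^sup>2\<close> in the norm and in the bilinear form require.
\<close>

definition admissible_coeffs ::
    "(real^'n) set \<Rightarrow> real \<Rightarrow> real \<Rightarrow> real \<Rightarrow> real \<Rightarrow> real \<Rightarrow>
     (real^'n \<Rightarrow> real^'n^'n) \<Rightarrow> (real^'n \<Rightarrow> real^'n) \<Rightarrow> (real^'n \<Rightarrow> real) \<Rightarrow> bool" where
  "admissible_coeffs \<Omega> \<Lambda>\<^sub>0 \<Lambda>\<^sub>1 \<beta> a\<^sub>0 a\<^sub>1 A b a \<longleftrightarrow>
     A \<in> borel_measurable (lebesgue_on \<Omega>) \<and>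
     b \<in> borel_measurable (lebesgue_on \<Omega>) \<and>
     a \<in> borel_measurable (lebesgue_on \<Omega>) \<and>
     (AE x in lebesgue_on (closure \<Omega>). transpose (A x) = A x \<and>
        (\<forall>\<xi>. \<Lambda>\<^sub>0 * (\<xi> \<bullet> \<xi>) \<le> \<xi> \<bullet> (A x *v \<xi>) \<and> \<xi> \<bullet> (A x *v \<xi>) \<le> \<Lambda>\<^sub>1 * (\<xi> \<bullet> \<xi>))) \<and>
     (AE x in lebesgue_on \<Omega>. norm (b x) \<le> \<beta>) \<and>
     (AE x in lebesgue_on \<Omega>. a\<^sub>0 \<le> a x \<and> a x \<le> a\<^sub>1)"

definition primal_solution where
  "primal_solution \<Omega> \<Gamma>\<^sub>D A b a f u \<longleftrightarrow> u \<in> H1_D \<Omega> \<Gamma>\<^sub>D \<and>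
     (\<forall>v\<in>H1_D \<Omega> \<Gamma>\<^sub>D.
        L2_inner \<Omega> (\<lambda>x. A x *v weak_grad \<Omega> u x) (weak_grad \<Omega> v) +
        L2_inner \<Omega> (\<lambda>x. b x \<bullet> weak_grad \<Omega> u x + a x * u x) v = L2_inner \<Omega> f v)"

definition dual_solution where
  "dual_solution \<Omega> \<Gamma>\<^sub>D A b a f z \<longleftrightarrow> z \<in> H1_D \<Omega> \<Gamma>\<^sub>D \<and>
     (\<forall>\<phi>\<in>H1_D \<Omega> \<Gamma>\<^sub>D.
        L2_inner \<Omega> (weak_grad \<Omega> \<phi>) (\<lambda>x. A x *v weak_grad \<Omega> z x + z x *\<^sub>R b x) +
        L2_inner \<Omega> \<phi> (\<lambda>x. a x * z x) = L2_inner \<Omega> f \<phi>)"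

text \<open>Unique solvability (in the sense of functions defined almost everywhere) of both problems for
  all square-integrable data, with the \<open>H\<^sup>2\<close> a priori estimate with constant \<open>K\<close>.\<close>

definition H2_regular where
  "H2_regular \<Omega> \<Gamma>\<^sub>D A b a K \<longleftrightarrow>
     (\<forall>f\<in>L2 \<Omega>.
        (\<exists>u. primal_solution \<Omega> \<Gamma>\<^sub>D A b a f u \<and> u \<in> H2 \<Omega> \<and> H2_norm \<Omega> u \<le> K * L2_norm \<Omega> f \<and>
             (\<forall>u'. primal_solution \<Omega> \<Gamma>\<^sub>D A b a f u' \<longrightarrow> (AE x in lebesgue_on \<Omega>. u' x = u x))) \<and>
        (\<exists>z. dual_solution \<Omega> \<Gamma>\<^sub>D A b a f z \<and> z \<in> H2 \<Omega> \<and> H2_norm \<Omega> z \<le> K * L2_norm \<Omega> f \<and>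
             (\<forall>z'. dual_solution \<Omega> \<Gamma>\<^sub>D A b a f z' \<longrightarrow> (AE x in lebesgue_on \<Omega>. z' x = z x))))"

section \<open>The least-squares form and the energy norm\<close>

text \<open>The symmetric positive semidefinite square root, unique for symmetric positive semidefinite
  \<open>M\<close>.\<close>

definition matrix_sqrt :: "real^'n^'n \<Rightarrow> real^'n^'n" where
  "matrix_sqrt M = (SOME B. transpose B = B \<and> (\<forall>\<xi>. 0 \<le> \<xi> \<bullet> (B *v \<xi>)) \<and> B ** B = M)"

definition ls_form ::
    "(real^'n) set \<Rightarrow> (real^'n \<Rightarrow> real^'n^'n) \<Rightarrow> (real^'n \<Rightarrow> real^'n) \<Rightarrow> (real^'n \<Rightarrow> real) \<Rightarrow>
     (real^'n \<Rightarrow> real^'n) \<times> (real^'n \<Rightarrow> real) \<Rightarrow> (real^'n \<Rightarrow> real^'n) \<times> (real^'n \<Rightarrow> real) \<Rightarrow> real" where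
  "ls_form \<Omega> A b a = (\<lambda>(\<eta>, w) (\<tau>, v).
     L2_inner \<Omega>
       (\<lambda>x. \<eta> x - (A x *v weak_grad \<Omega> w x + w x *\<^sub>R b x))
       (\<lambda>x. matrix_inv (A x) *v \<tau> x - (weak_grad \<Omega> v x + v x *\<^sub>R (matrix_inv (A x) *v b x))) +
     L2_inner \<Omega>
       (\<lambda>x. inverse (a x) * weak_div \<Omega> \<eta> x - w x)
       (\<lambda>x. weak_div \<Omega> \<tau> x - a x * v x))"

definition energy_norm ::
    "(real^'n) set \<Rightarrow> (real^'n \<Rightarrow> real^'n^'n) \<Rightarrow> (real^'n \<Rightarrow> real) \<Rightarrow>
     (real^'n \<Rightarrow> real^'n) \<times> (real^'n \<Rightarrow> real) \<Rightarrow> real" where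
  "energy_norm \<Omega> A a = (\<lambda>(\<tau>, v). sqrt (
     (L2_norm \<Omega> (\<lambda>x. sqrt (a x) * v x))\<^sup>2 +
     (L2_norm \<Omega> (\<lambda>x. matrix_sqrt (A x) *v weak_grad \<Omega> v x))\<^sup>2 +
     (L2_norm \<Omega> (\<lambda>x. matrix_inv (matrix_sqrt (A x)) *v \<tau> x))\<^sup>2 +
     (L2_norm \<Omega> (\<lambda>x. inverse (sqrt (a x)) * weak_div \<Omega> \<tau> x))\<^sup>2))"

end

theory Submission
  imports Defs
begin

text \<open>
  Write \<open>r = \<tau> - A \<nabla>v - b v\<close> and \<open>s = div \<tau> - a v\<close>. Then the form at \<open>(\<tau>, v)\<close> is
  \<open>(r, A\<inverse> r) + (a\<inverse> s, s)\<close>, so continuity is the Cauchy--Schwarz inequality and coercivity means that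
  \<open>r\<close> and \<open>s\<close> control \<open>\<tau>\<close> and \<open>v\<close>. Since the normal trace of \<open>\<tau>\<close> vanishes on \<open>\<Gamma>\<^sub>N\<close>, Green's formula
  gives \<open>(A \<nabla>v + b v, \<nabla>\<phi>) + (a v, \<phi>) = - (r, \<nabla>\<phi>) - (s, \<phi>)\<close> for all \<open>\<phi>\<close> vanishing on \<open>\<Gamma>\<^sub>D\<close>. Taking for
  \<open>\<phi>\<close> the solution of the primal problem with right-hand side \<open>v\<close> turns the left-hand side into
  \<open>\<parallel>v\<parallel>\<^sup>2\<close>, and the a priori estimate yields \<open>\<parallel>v\<parallel> \<le> K (\<parallel>r\<parallel> + \<parallel>s\<parallel>)\<close>. With \<open>\<phi> = v\<close> the ellipticity of \<open>A\<close> then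
  bounds \<open>\<nabla>v\<close>, and \<open>\<tau>\<close> and \<open>div \<tau>\<close> are recovered from \<open>r\<close> and \<open>s\<close>.
\<close>

section \<open>Symmetric positive definite matrices\<close>

lemma matrix_vector_mul_inner: "(M *v x) \<bullet> y = x \<bullet> (transpose M *v y)"
  for M :: "real^'n^'m"
  by (metis dot_lmul_matrix inner_commute vector_transpose_matrix)

lemma
  fixes M :: "real^'n^'n"
  assumes "invertible M"
  shows matrix_inv_right: "M ** matrix_inv M = mat 1"
    and matrix_inv_left: "matrix_inv M ** M = mat 1"
  using someI_ex[OF assms[unfolded invertible_def]] unfolding matrix_inv_def by auto

text \<open>Collects what ellipticity says about the coefficient matrix at a single point. The
  results below concern one fixed matrix and are later applied at almost every point of the domain,
  with \<open>l\<close> and \<open>L\<close> the ellipticity constants.\<close>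

locale spd_matrix =
  fixes M :: "real^'n^'n" and l L :: real
  assumes sym: "transpose M = M"
    and l_pos: "0 < l"
    and lower: "\<And>\<xi>. l * (\<xi> \<bullet> \<xi>) \<le> \<xi> \<bullet> (M *v \<xi>)"
    and upper: "\<And>\<xi>. \<xi> \<bullet> (M *v \<xi>) \<le> L * (\<xi> \<bullet> \<xi>)"
begin

lemma self_adjoint: "(M *v x) \<bullet> y = x \<bullet> (M *v y)"
  using matrix_vector_mul_inner[of M x y] sym by simp

text \<open>Both bounds are tested on a unit coordinate vector, which exists because the index type
  is nonempty.\<close>

lemma le_bounds: "l \<le> L"
proof -
  fix i :: 'n
  show ?thesis
    using lower[of "axis i 1"] upper[of "axis i 1"] by (simp add: inner_axis_axis)
qed

end

text \<open>The quadratic form of \<open>T\<close> is nonnegative at \<open>c x - T x\<close>.\<close>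

lemma psd_norm_image_le:
  fixes T :: "'a::real_inner \<Rightarrow> 'a"
  assumes T: "linear T" and sa: "\<And>x y. T x \<bullet> y = x \<bullet> T y"
    and pos: "\<And>x. 0 \<le> x \<bullet> T x" and upper: "\<And>x. x \<bullet> T x \<le> c * (x \<bullet> x)"
  shows "(norm (T x))\<^sup>2 \<le> c * (x \<bullet> T x)"
proof (cases "T x = 0")
  case True
  then show ?thesis by simp
next
  case False
  define n where "n = (norm (T x))\<^sup>2"
  have n: "n > 0" "T x \<bullet> T x = n"
    using False by (auto simp: n_def power2_norm_eq_inner)
  have c: "0 \<le> c"
    using order_trans[OF pos[of "T x"] upper[of "T x"]] n by (simp add: zero_le_mult_iff)
  \<comment> \<open>Self-adjointness makes both mixed terms equal to \<open>n\<close>, after scaling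
    by \<open>c\<close>.\<close>
  have ev: "(c *\<^sub>R x - T x) \<bullet> T (c *\<^sub>R x - T x) = c\<^sup>2 * (x \<bullet> T x) - 2 * c * n + T x \<bullet> T (T x)"
    using n(2) sa[of x "T x"]
    by (simp add: linear_diff[OF T] linear_scale[OF T] inner_diff inner_commute power2_eq_square
        algebra_simps)
  \<comment> \<open>The last term of \<open>ev\<close> is at most \<open>c * n\<close> by
    \<open>upper\<close> at \<open>T x\<close>. Cancelling one factor \<open>c\<close> then leaves
    the claim.\<close>
  have "0 \<le> c\<^sup>2 * (x \<bullet> T x) - 2 * c * n + c * n"
    using pos[of "c *\<^sub>R x - T x"] upper[of "T x"] unfolding ev n by linarith
  then have "c * n \<le> c * (c * (x \<bullet> T x))"
    by (simp add: power2_eq_square algebra_simps)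
  \<comment> \<open>For \<open>c = 0\<close> the quadratic form of \<open>T\<close> would vanish
    identically, yet at \<open>x + T x\<close> it would equal \<open>2 * n > 0\<close>.\<close>
  moreover have "c \<noteq> 0"
  proof
    assume "c = 0"
    then have z: "\<And>y. y \<bullet> T y = 0"
      using pos upper by (metis antisym mult_zero_left)
    have "(x + T x) \<bullet> T (x + T x) = x \<bullet> T x + 2 * n + T x \<bullet> T (T x)"
      using n(2) sa[of x "T x"] by (simp add: linear_add[OF T] inner_add algebra_simps)
    with z n show False by simp
  qed
  ultimately show ?thesis
    using c by (simp add: n_def)
qed

text \<open>A solution of \<open>Y = (T + Y\<^sup>2) / 2\<close> gives the square root \<open>1 - Y\<close> of \<open>1 - T\<close>; the right-hand side
  is a contraction on the ball of radius \<open>norm T < 1\<close>.\<close>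

lemma self_adjoint_sqrt_of_one_minus:
  fixes T :: "('a::euclidean_space) \<Rightarrow>\<^sub>L 'a"
  assumes sa: "\<And>x y. blinfun_apply T x \<bullet> y = x \<bullet> blinfun_apply T y" and c: "norm T \<le> c" "c < 1"
  shows "\<exists>Y :: 'a \<Rightarrow>\<^sub>L 'a. (\<forall>x y. blinfun_apply Y x \<bullet> y = x \<bullet> blinfun_apply Y y) \<and> norm Y \<le> c \<and>
    (\<forall>x. 2 *\<^sub>R blinfun_apply Y x = blinfun_apply T x + blinfun_apply Y (blinfun_apply Y x))"
proof -
  \<comment> \<open>Self-adjointness is a closed condition preserved by the iteration. Building it
    into the complete set \<open>S\<close> passes it on to the fixed point.\<close>
  define S where "S = {Y :: 'a \<Rightarrow>\<^sub>L 'a. norm Y \<le> c \<and> (\<forall>x y. blinfun_apply Y x \<bullet> y = x \<bullet> blinfun_apply Y y)}"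
  define F where "F = (\<lambda>Y :: 'a \<Rightarrow>\<^sub>L 'a. (1/2) *\<^sub>R (T + (Y o\<^sub>L Y)))"
  have c0: "0 \<le> c" using c(1) norm_ge_zero order_trans by blast
  have "closed S"
    unfolding S_def
    by (intro closed_Collect_conj closed_Collect_all closed_Collect_le closed_Collect_eq
        continuous_intros)
  then have "complete S" by (simp add: complete_eq_closed)
  moreover have "0 \<in> S" using c0 by (simp add: S_def)
  moreover have "F ` S \<subseteq> S"
  proof (rule image_subsetI)
    fix Y assume "Y \<in> S"
    then have Y: "norm Y \<le> c" and Y_sa: "\<And>x y. blinfun_apply Y x \<bullet> y = x \<bullet> blinfun_apply Y y"
      by (auto simp: S_def)
    have "norm (T + (Y o\<^sub>L Y)) \<le> c + c * c"
      using norm_triangle_ineq[of T "Y o\<^sub>L Y"] norm_blinfun_compose[of Y Y]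
        mult_mono[OF Y Y c0 norm_ge_zero] c(1) by linarith
    moreover have "c * c \<le> c" using c0 c(2) by (simp add: mult_left_le)
    ultimately have "norm (F Y) \<le> c" by (simp add: F_def)
    moreover have "blinfun_apply (F Y) x \<bullet> y = x \<bullet> blinfun_apply (F Y) y" for x y
      by (simp add: F_def blinfun.bilinear_simps inner_add sa Y_sa)
    ultimately show "F Y \<in> S" by (simp add: S_def)
  qed
  moreover have "dist (F X) (F Y) \<le> c * dist X Y" if "X \<in> S" "Y \<in> S" for X Y
  proof -
    have XY: "norm X \<le> c" "norm Y \<le> c" using that by (auto simp: S_def)
    \<comment> \<open>Since \<open>X\<close> and \<open>Y\<close> need not commute, the difference
      of squares is split as X (X - Y) + (X - Y) Y. Each summand contributes half of the contraction
      constant \<open>c\<close>.\<close>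
    have "F X - F Y = (1/2) *\<^sub>R ((X o\<^sub>L (X - Y)) + ((X - Y) o\<^sub>L Y))"
      by (auto simp: F_def intro!: blinfun_eqI simp: blinfun.bilinear_simps algebra_simps)
    then have "norm (F X - F Y) \<le> (norm (X o\<^sub>L (X - Y)) + norm ((X - Y) o\<^sub>L Y)) / 2"
      using norm_triangle_ineq[of "X o\<^sub>L (X - Y)" "(X - Y) o\<^sub>L Y"] by simp
    also have "\<dots> \<le> (c * norm (X - Y) + norm (X - Y) * c) / 2"
      by (intro divide_right_mono add_mono order_trans[OF norm_blinfun_compose]
          mult_right_mono mult_left_mono XY) auto
    finally show ?thesis by (simp add: dist_norm mult.commute)
  qed
  ultimately obtain Y where Y: "Y \<in> S" "F Y = Y"
    using Banach_fix[of S c F] c0 c(2) by blast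
  have "2 *\<^sub>R blinfun_apply Y x = blinfun_apply T x + blinfun_apply Y (blinfun_apply Y x)" for x
  proof -
    have "blinfun_apply Y x = blinfun_apply (F Y) x" by (simp only: Y(2))
    then have "2 *\<^sub>R blinfun_apply Y x = 2 *\<^sub>R blinfun_apply (F Y) x" by (rule arg_cong)
    then show ?thesis by (simp add: F_def blinfun.bilinear_simps)
  qed
  with Y(1) show ?thesis by (auto simp: S_def)
qed

section \<open>Bounds, inverse and square root of a positive definite matrix\<close>

context spd_matrix
begin

lemma L_pos: "0 < L"
  using l_pos le_bounds by linarith

lemma inner_nonneg: "0 \<le> x \<bullet> (M *v x)"
  using lower[of x] l_pos by (meson inner_ge_zero mult_nonneg_nonneg less_imp_le order_trans)

text \<open>Keeping the quadratic form on the right, instead of \<open>L * norm x\<close>, is what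
  later gives the sharp lower bound \<open>1 / L\<close> for the form of the inverse.\<close>

lemma norm_mult_sq_le: "(norm (M *v x))\<^sup>2 \<le> L * (x \<bullet> (M *v x))"
  by (rule psd_norm_image_le) (auto simp: self_adjoint inner_nonneg upper)

lemma norm_mult_le: "norm (M *v x) \<le> L * norm x"
proof -
  have "(norm (M *v x))\<^sup>2 \<le> L * (L * (x \<bullet> x))"
    using norm_mult_sq_le[of x] mult_left_mono[OF upper[of x], of L] L_pos by linarith
  also have "\<dots> = (L * norm x)\<^sup>2"
    by (simp add: power2_norm_eq_inner[symmetric] power2_eq_square)
  finally show ?thesis
    by (rule power2_le_imp_le) (use L_pos in simp)
qed

text \<open>Cauchy-Schwarz applied to the lower bound of the form, followed by division by
  \<open>norm x\<close>. It yields injectivity and the bound for the inverse.\<close>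

lemma norm_le_norm_mult: "l * norm x \<le> norm (M *v x)"
proof (cases "x = 0")
  case False
  have "(l * norm x) * norm x \<le> norm (M *v x) * norm x"
    using lower[of x] norm_cauchy_schwarz[of x "M *v x"]
    by (simp add: power2_norm_eq_inner[symmetric] power2_eq_square algebra_simps)
  with False show ?thesis by simp
qed simp

lemma invertible: "invertible M"
proof -
  have "inj ((*v) M)"
  proof (rule injI)
    fix x y assume "M *v x = M *v y"
    then have "l * norm (x - y) \<le> 0"
      using norm_le_norm_mult[of "x - y"] by (simp add: matrix_vector_mult_diff_distrib)
    with l_pos show "x = y" by (simp add: mult_le_0_iff)
  qed
  then show ?thesis
    using invertible_left_inverse matrix_left_invertible_injective by blast
qed

lemma mult_inv: "M *v (matrix_inv M *v x) = x"
  by (simp add: matrix_vector_mul_assoc matrix_inv_right[OF invertible])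

lemma inv_mult: "matrix_inv M *v (M *v x) = x"
  by (simp add: matrix_vector_mul_assoc matrix_inv_left[OF invertible])

lemma norm_inv_mult_le: "norm (matrix_inv M *v x) \<le> (1 / l) * norm x"
  using norm_le_norm_mult[of "matrix_inv M *v x"] l_pos by (simp add: mult_inv field_simps)

lemma inner_inv_mult_le: "x \<bullet> (matrix_inv M *v x) \<le> (1 / l) * (norm x)\<^sup>2"
proof -
  have "x \<bullet> (matrix_inv M *v x) \<le> norm x * ((1 / l) * norm x)"
    using norm_cauchy_schwarz[of x "matrix_inv M *v x"]
      mult_left_mono[OF norm_inv_mult_le[of x] norm_ge_zero[of x]] by linarith
  then show ?thesis by (simp add: power2_eq_square)
qed

text \<open>This is \<open>norm_mult_sq_le\<close> at the vector
  \<open>matrix_inv M *v x\<close>.\<close>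

lemma inner_inv_mult_ge: "(1 / L) * (norm x)\<^sup>2 \<le> x \<bullet> (matrix_inv M *v x)"
  using norm_mult_sq_le[of "matrix_inv M *v x"] L_pos
  by (simp add: mult_inv inner_commute field_simps)

text \<open>After division by \<open>L\<close> the matrix is 1 - T with T self-adjoint and of norm
  at most \<open>c = 1 - l / L < 1\<close>. The fixed point Y of the preceding contraction then
  gives the root \<open>sqrt L\<close> times 1 - Y. Existence is what makes the choice in
  \<open>matrix_sqrt\<close> meaningful.\<close>

lemma has_matrix_sqrt:
  "\<exists>B. transpose B = B \<and> (\<forall>\<xi>. 0 \<le> \<xi> \<bullet> (B *v \<xi>)) \<and> B ** B = M"
proof -
  define c where "c = 1 - l / L"
  have c: "0 \<le> c" "c < 1"
    using l_pos le_bounds by (auto simp: c_def)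
  define T where "T = (\<lambda>x. x - (1 / L) *\<^sub>R (M *v x))"
  have T: "bounded_linear T"
    unfolding T_def by (intro bounded_linear_intros matrix_vector_mul_bounded_linear)
  have T_sa: "T x \<bullet> y = x \<bullet> T y" for x y
    by (simp add: T_def inner_diff self_adjoint)
  have "norm (T x) \<le> c * norm x" for x
  proof -
    have up: "y \<bullet> T y \<le> c * (y \<bullet> y)" for y
      using lower[of y] L_pos by (simp add: T_def c_def inner_diff field_simps)
    have "0 \<le> y \<bullet> T y" for y
      using upper[of y] L_pos by (simp add: T_def inner_diff field_simps)
    then have "(norm (T x))\<^sup>2 \<le> c * (x \<bullet> T x)"
      using T up T_sa by (intro psd_norm_image_le) (auto simp: bounded_linear.linear)
    also have "\<dots> \<le> c * (c * (x \<bullet> x))"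
      using up c(1) by (intro mult_left_mono) auto
    also have "\<dots> = (c * norm x)\<^sup>2"
      by (simp add: power2_norm_eq_inner[symmetric] power2_eq_square)
    finally show ?thesis
      by (rule power2_le_imp_le) (use c(1) in simp)
  qed
  then have "norm (Blinfun T) \<le> c"
    using c(1) by (intro norm_blinfun_bound) (auto simp: bounded_linear_Blinfun_apply[OF T])
  then obtain Y :: "(real^'n) \<Rightarrow>\<^sub>L (real^'n)" where Y: "\<And>x y. blinfun_apply Y x \<bullet> y = x \<bullet> blinfun_apply Y y"
      "norm Y \<le> c" "\<And>x. 2 *\<^sub>R blinfun_apply Y x = T x + blinfun_apply Y (blinfun_apply Y x)"
    using self_adjoint_sqrt_of_one_minus[of "Blinfun T" c] c(2) T_sa
    by (auto simp: bounded_linear_Blinfun_apply[OF T])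
  define B where "B = matrix (\<lambda>x. sqrt L *\<^sub>R (x - blinfun_apply Y x))"
  have B: "B *v x = sqrt L *\<^sub>R (x - blinfun_apply Y x)" for x
    unfolding B_def
    by (intro fun_cong[OF matrix_vector_mul(3)] bounded_linear_intros)
  have "transpose B = B"
  proof -
    have "transpose B *v y = B *v y" for y
    proof (rule vector_eq_ldot[THEN iffD1], rule allI)
      fix x
      show "x \<bullet> (transpose B *v y) = x \<bullet> (B *v y)"
        unfolding matrix_vector_mul_inner[symmetric] B by (simp add: inner_diff Y(1))
    qed
    then show ?thesis by (simp add: matrix_eq)
  qed
  moreover have "0 \<le> x \<bullet> (B *v x)" for x
  proof -
    \<comment> \<open>The norm of \<open>Y\<close> is below 1, so the form of \<open>Y\<close> is
      dominated by that of the identity.\<close>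
    have "x \<bullet> blinfun_apply Y x \<le> norm x * (c * norm x)"
      using norm_cauchy_schwarz[of x "blinfun_apply Y x"] norm_blinfun[of Y x]
        mult_right_mono[OF Y(2) norm_ge_zero[of x]]
      by (meson mult_left_mono norm_ge_zero order_trans)
    also have "\<dots> \<le> x \<bullet> x"
      using c mult_left_mono[of "c * norm x" "norm x" "norm x"]
      by (simp add: power2_norm_eq_inner[symmetric] power2_eq_square mult_left_le_one_le)
    finally show ?thesis using L_pos by (simp add: B inner_diff)
  qed
  moreover have "B ** B = M"
  proof -
    have "B *v (B *v x) = M *v x" for x
    proof -
      \<comment> \<open>The fixed point equation \<open>Y(3)\<close> says 1 - 2Y + Y^2 = 1 - T, and
        1 - T is \<open>M\<close> divided by \<open>L\<close>.\<close>
      have "B *v (B *v x) = L *\<^sub>R (x - 2 *\<^sub>R blinfun_apply Y x + blinfun_apply Y (blinfun_apply Y x))"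
        using L_pos by (simp add: B blinfun.bilinear_simps algebra_simps scaleR_2)
      also have "\<dots> = M *v x"
        using L_pos by (simp add: Y(3)) (simp add: T_def)
      finally show ?thesis .
    qed
    then show ?thesis by (simp add: matrix_eq matrix_vector_mul_assoc)
  qed
  ultimately show ?thesis by blast
qed

lemma
  shows transpose_matrix_sqrt: "transpose (matrix_sqrt M) = matrix_sqrt M"
    and matrix_sqrt_mult_self: "matrix_sqrt M ** matrix_sqrt M = M"
  using someI_ex[OF has_matrix_sqrt] unfolding matrix_sqrt_def by auto

text \<open>One symmetric factor moves across the inner product. This rewrites the weighted norms of
  the energy norm as quadratic forms in which no root occurs.\<close>

lemma norm_matrix_sqrt_mult: "(norm (matrix_sqrt M *v x))\<^sup>2 = x \<bullet> (M *v x)"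
  by (simp add: power2_norm_eq_inner matrix_vector_mul_inner transpose_matrix_sqrt
      matrix_vector_mul_assoc matrix_sqrt_mult_self)

lemma norm_inv_matrix_sqrt_mult:
  "(norm (matrix_inv (matrix_sqrt M) *v x))\<^sup>2 = x \<bullet> (matrix_inv M *v x)"
proof -
  \<comment> \<open>The determinant of \<open>M\<close> is the square of that of its root and does
    not vanish.\<close>
  have inv: "invertible (matrix_sqrt M)"
    using invertible by (metis det_mul invertible_det_nz matrix_sqrt_mult_self mult_zero_left)
  define y where "y = matrix_inv (matrix_sqrt M) *v x"
  have "matrix_sqrt M *v y = x"
    by (simp add: y_def matrix_vector_mul_assoc matrix_inv_right[OF inv])
  \<comment> \<open>Hence the squared norm of \<open>y\<close> is the inner product of
    \<open>y\<close> with the root applied to \<open>matrix_inv M *v x\<close>. Moving the root back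
    onto \<open>y\<close> turns \<open>y\<close> into \<open>x\<close>.\<close>
  moreover have "matrix_sqrt M *v (matrix_inv M *v x) = y"
    using inv_mult mult_inv
    by (metis y_def inv matrix_inv_left matrix_sqrt_mult_self matrix_vector_mul_assoc
        matrix_vector_mul_lid)
  ultimately show ?thesis
    unfolding y_def[symmetric]
    by (metis matrix_vector_mul_inner power2_norm_eq_inner transpose_matrix_sqrt)
qed

end

section \<open>Measurability of matrix-valued maps\<close>

lemma borel_measurable_vec_nth [measurable]:
  fixes f :: "'a \<Rightarrow> ('b::euclidean_space)^'n"
  assumes "f \<in> borel_measurable M"
  shows "(\<lambda>x. f x $ i) \<in> borel_measurable M"
  by (rule measurable_compose[OF assms borel_measurable_continuous_onI])
    (intro continuous_intros)

lemma borel_measurable_vec_lambda: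
  fixes f :: "'a \<Rightarrow> real^'n"
  assumes "\<And>i. (\<lambda>x. f x $ i) \<in> borel_measurable M"
  shows "f \<in> borel_measurable M"
proof -
  have "(\<lambda>x. f x \<bullet> e) \<in> borel_measurable M" if "e \<in> Basis" for e
    using that assms by (auto simp: Basis_vec_def inner_axis)
  then show ?thesis by (subst borel_measurable_euclidean_space) blast
qed

lemma borel_measurable_matrix_vector_mult [measurable (raw)]:
  fixes A :: "'a \<Rightarrow> real^'n^'m"
  assumes [measurable]: "A \<in> borel_measurable M" "f \<in> borel_measurable M"
  shows "(\<lambda>x. A x *v f x) \<in> borel_measurable M"
  by (rule borel_measurable_vec_lambda) (simp add: matrix_vector_mul_component)

lemma borel_measurable_det:
  fixes A :: "'a \<Rightarrow> real^'n^'n"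
  assumes "\<And>i j. (\<lambda>x. A x $ i $ j) \<in> borel_measurable M"
  shows "(\<lambda>x. det (A x)) \<in> borel_measurable M"
  using assms unfolding det_def by (intro borel_measurable_sum borel_measurable_times borel_measurable_prod) auto

text \<open>Completeness of Lebesgue measure. It serves for expressions in \<open>matrix_inv\<close>
  and \<open>matrix_sqrt\<close>, which agree with explicitly measurable functions only almost
  everywhere.\<close>

lemma borel_measurable_lebesgue_on_AE:
  fixes f :: "'a::euclidean_space \<Rightarrow> 'b::euclidean_space"
  assumes S: "S \<in> sets lebesgue" and f: "f \<in> borel_measurable (lebesgue_on S)"
    and ae: "AE x in lebesgue_on S. f x = g x"
  shows "g \<in> borel_measurable (lebesgue_on S)"
proof (rule borel_measurable_if_D)
  have "AE x in lebesgue. x \<in> S \<longrightarrow> f x = g x"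
    using ae S by (simp add: AE_restrict_space_iff)
  then show "(\<lambda>x. if x \<in> S then g x else 0) \<in> borel_measurable lebesgue"
    by (intro borel_measurable_AE[OF borel_measurable_if_I[OF f S]]) auto
qed

text \<open>By Cramer's rule.\<close>

lemma borel_measurable_matrix_inv_mult:
  fixes A :: "real^'n \<Rightarrow> real^'m^'m"
  assumes S: "S \<in> sets lebesgue" and A: "A \<in> borel_measurable (lebesgue_on S)"
    and f: "f \<in> borel_measurable (lebesgue_on S)"
    and inv: "AE x in lebesgue_on S. invertible (A x)"
  shows "(\<lambda>x. matrix_inv (A x) *v f x) \<in> borel_measurable (lebesgue_on S)"
proof (rule borel_measurable_lebesgue_on_AE[OF S])
  note [measurable] = A f
  \<comment> \<open>The numerator for component \<open>k\<close> has column \<open>k\<close>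
    replaced by \<open>f x\<close>. Like the denominator, it is a polynomial in measurable
    entries.\<close>
  have "(\<lambda>x. det (\<chi> i j. if j = k then f x $ i else A x $ i $ j))
      \<in> borel_measurable (lebesgue_on S)" for k
  proof (rule borel_measurable_det)
    fix i j
    show "(\<lambda>x. (\<chi> i j. if j = k then f x $ i else A x $ i $ j) $ i $ j)
        \<in> borel_measurable (lebesgue_on S)"
      by (cases "j = k") simp_all
  qed
  moreover have "(\<lambda>x. det (A x)) \<in> borel_measurable (lebesgue_on S)"
    by (intro borel_measurable_det borel_measurable_vec_nth A)
  ultimately show "(\<lambda>x. \<chi> k. det (\<chi> i j. if j = k then f x $ i else A x $ i $ j) / det (A x))
      \<in> borel_measurable (lebesgue_on S)"
    by (intro borel_measurable_vec_lambda) simp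
  show "AE x in lebesgue_on S.
      (\<chi> k. det (\<chi> i j. if j = k then f x $ i else A x $ i $ j) / det (A x)) =
      matrix_inv (A x) *v f x"
    using inv
  proof eventually_elim
    case (elim x)
    then have "A x *v (matrix_inv (A x) *v f x) = f x"
      by (simp add: matrix_vector_mul_assoc matrix_inv_right)
    moreover have "det (A x) \<noteq> 0"
      using elim invertible_det_nz by blast
    ultimately show ?case
      using cramer[of "A x" "matrix_inv (A x) *v f x" "f x"] by simp
  qed
qed

section \<open>The space of square-integrable functions\<close>

lemma L2_measurable [measurable_dest]: "f \<in> L2 \<Omega> \<Longrightarrow> f \<in> borel_measurable (lebesgue_on \<Omega>)"
  by (simp add: L2_def)

lemma L2_integrable: "f \<in> L2 \<Omega> \<Longrightarrow> integrable (lebesgue_on \<Omega>) (\<lambda>x. (norm (f x))\<^sup>2)"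
  by (simp add: L2_def)

lemma L2_norm_nonneg [simp]: "0 \<le> L2_norm \<Omega> f"
  by (simp add: L2_norm_def)

lemma L2_norm_sq: "(L2_norm \<Omega> f)\<^sup>2 = (LINT x|lebesgue_on \<Omega>. (norm (f x))\<^sup>2)"
  by (simp add: L2_norm_def)

lemma L2_inner_self: "L2_inner \<Omega> f f = (L2_norm \<Omega> f)\<^sup>2"
  by (simp add: L2_inner_def L2_norm_sq power2_norm_eq_inner)

text \<open>Integrates a pointwise two-sided bound. As \<open>l\<close> is nonnegative, so is
  \<open>h\<close> almost everywhere, and the upper bound then dominates it by an integrable
  function.\<close>

lemma integral_bounds_L2:
  assumes f: "f \<in> L2 \<Omega>" and h: "h \<in> borel_measurable (lebesgue_on \<Omega>)" and "0 \<le> l"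
    and ae: "AE x in lebesgue_on \<Omega>. l * (norm (f x))\<^sup>2 \<le> h x \<and> h x \<le> u * (norm (f x))\<^sup>2"
  shows "integrable (lebesgue_on \<Omega>) h"
    and "l * (L2_norm \<Omega> f)\<^sup>2 \<le> (LINT x|lebesgue_on \<Omega>. h x)"
    and "(LINT x|lebesgue_on \<Omega>. h x) \<le> u * (L2_norm \<Omega> f)\<^sup>2"
proof -
  note int = integrable_mult_right[OF L2_integrable[OF f]]
  show h_int: "integrable (lebesgue_on \<Omega>) h"
  proof (rule Bochner_Integration.integrable_bound[OF int[of u] h])
    show "AE x in lebesgue_on \<Omega>. norm (h x) \<le> norm (u * (norm (f x))\<^sup>2)"
      using ae
    proof eventually_elim
      case (elim x)
      moreover have "0 \<le> l * (norm (f x))\<^sup>2" using \<open>0 \<le> l\<close> by simp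
      ultimately have "0 \<le> h x" "h x \<le> u * (norm (f x))\<^sup>2" by linarith+
      then show ?case unfolding real_norm_def by linarith
    qed
  qed
  have "(LINT x|lebesgue_on \<Omega>. l * (norm (f x))\<^sup>2) \<le> (LINT x|lebesgue_on \<Omega>. h x)"
    using ae by (intro integral_mono_AE int h_int) auto
  then show "l * (L2_norm \<Omega> f)\<^sup>2 \<le> (LINT x|lebesgue_on \<Omega>. h x)"
    by (simp add: L2_norm_sq)
  have "(LINT x|lebesgue_on \<Omega>. h x) \<le> (LINT x|lebesgue_on \<Omega>. u * (norm (f x))\<^sup>2)"
    using ae by (intro integral_mono_AE int h_int) auto
  then show "(LINT x|lebesgue_on \<Omega>. h x) \<le> u * (L2_norm \<Omega> f)\<^sup>2"
    by (simp add: L2_norm_sq)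
qed

text \<open>The preceding lemma for the squared norm of \<open>g\<close>, with lower constant 0 and
  upper constant \<open>c\<close> squared.\<close>

lemma L2_bound:
  assumes f: "f \<in> L2 \<Omega>" and g: "g \<in> borel_measurable (lebesgue_on \<Omega>)" and "0 \<le> c"
    and ae: "AE x in lebesgue_on \<Omega>. norm (g x) \<le> c * norm (f x)"
  shows "g \<in> L2 \<Omega>" and "L2_norm \<Omega> g \<le> c * L2_norm \<Omega> f"
proof -
  have m: "(\<lambda>x. (norm (g x))\<^sup>2) \<in> borel_measurable (lebesgue_on \<Omega>)"
    using g by measurable
  have ae2: "AE x in lebesgue_on \<Omega>. 0 * (norm (f x))\<^sup>2 \<le> (norm (g x))\<^sup>2 \<and>
      (norm (g x))\<^sup>2 \<le> c\<^sup>2 * (norm (f x))\<^sup>2"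
    using ae
  proof eventually_elim
    case (elim x)
    show ?case using power_mono[OF elim norm_ge_zero, of 2] by (simp add: power_mult_distrib)
  qed
  note bds = integral_bounds_L2[OF f m order_refl ae2]
  show "g \<in> L2 \<Omega>" using bds(1) g by (simp add: L2_def)
  show "L2_norm \<Omega> g \<le> c * L2_norm \<Omega> f"
    by (rule power2_le_imp_le) (use bds(3) \<open>0 \<le> c\<close> in \<open>simp_all add: L2_norm_sq power_mult_distrib\<close>)
qed

lemma integrable_norm_mult_norm:
  assumes f: "f \<in> L2 \<Omega>" and g: "g \<in> L2 \<Omega>"
  shows "integrable (lebesgue_on \<Omega>) (\<lambda>x. norm (f x) * norm (g x))"
proof (rule Bochner_Integration.integrable_bound)
  show "integrable (lebesgue_on \<Omega>) (\<lambda>x. (norm (f x))\<^sup>2 + (norm (g x))\<^sup>2)"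
    using f g by (intro Bochner_Integration.integrable_add L2_integrable)
  show "(\<lambda>x. norm (f x) * norm (g x)) \<in> borel_measurable (lebesgue_on \<Omega>)"
    using L2_measurable[OF f] L2_measurable[OF g] by measurable
  have "s * t \<le> s\<^sup>2 + t\<^sup>2" if "0 \<le> s" "0 \<le> t" for s t :: real
    using sum_squares_bound[of s t] mult_nonneg_nonneg[OF that] by linarith
  then show "AE x in lebesgue_on \<Omega>. norm (norm (f x) * norm (g x)) \<le>
      norm ((norm (f x))\<^sup>2 + (norm (g x))\<^sup>2)"
    by (intro AE_I2) (simp add: abs_mult)
qed

lemma integrable_inner_L2:
  assumes f: "f \<in> L2 \<Omega>" and g: "g \<in> L2 \<Omega>"
  shows "integrable (lebesgue_on \<Omega>) (\<lambda>x. f x \<bullet> g x)"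
proof (rule Bochner_Integration.integrable_bound[OF integrable_norm_mult_norm[OF f g]])
  show "(\<lambda>x. f x \<bullet> g x) \<in> borel_measurable (lebesgue_on \<Omega>)"
    using L2_measurable[OF f] L2_measurable[OF g] by measurable
qed (auto simp: Cauchy_Schwarz_ineq2)

text \<open>The quadratic polynomial \<open>t \<mapsto> \<integral> (t |f| - |g|)\<^sup>2\<close> is nonnegative, so its
  discriminant is nonpositive.\<close>

lemma integral_norm_mult_norm_le:
  assumes f: "f \<in> L2 \<Omega>" and g: "g \<in> L2 \<Omega>"
  shows "(LINT x|lebesgue_on \<Omega>. norm (f x) * norm (g x)) \<le> L2_norm \<Omega> f * L2_norm \<Omega> g"
proof -
  define P where "P = (LINT x|lebesgue_on \<Omega>. norm (f x) * norm (g x))"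
  let ?F = "(L2_norm \<Omega> f)\<^sup>2" and ?G = "(L2_norm \<Omega> g)\<^sup>2"
  note int = L2_integrable[OF f] L2_integrable[OF g] integrable_norm_mult_norm[OF f g]
  have quad: "0 \<le> ?F * t\<^sup>2 + (-2 * P) * t + ?G" for t
  proof -
    have "0 \<le> (LINT x|lebesgue_on \<Omega>. (t * norm (f x) - norm (g x))\<^sup>2)"
      by simp
    also have "\<dots> = (LINT x|lebesgue_on \<Omega>. t\<^sup>2 * (norm (f x))\<^sup>2 + (norm (g x))\<^sup>2 -
        2 * t * (norm (f x) * norm (g x)))"
      by (intro Bochner_Integration.integral_cong refl)
        (simp add: power2_diff power_mult_distrib)
    also have "\<dots> = t\<^sup>2 * ?F + ?G - 2 * t * P"
      using int by (simp add: L2_norm_sq P_def)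
    finally show ?thesis by (simp add: algebra_simps)
  qed
  have P: "P\<^sup>2 \<le> ?F * ?G"
  proof (cases "?F = 0")
    case True
    then have "0 \<le> - 2 * P * t + ?G" for t using quad[of t] by simp
    \<comment> \<open>If \<open>P\<close> were nonzero, the affine function would take the value -1
      at this point.\<close>
    from this[of "(?G + 1) / (2 * P)"] have "P = 0" by (cases "P = 0") auto
    then show ?thesis by simp
  next
    case False
    then have F: "?F > 0" by simp
    \<comment> \<open>The quadratic polynomial attains its minimum at \<open>P / ?F\<close>.\<close>
    have "?F * (P / ?F)\<^sup>2 + (-2 * P) * (P / ?F) = - (P\<^sup>2 / ?F)"
      using F by (simp add: field_simps power2_eq_square)
    then have "P\<^sup>2 / ?F \<le> ?G" using quad[of "P / ?F"] by linarith
    then show ?thesis using F by (simp add: field_simps)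
  qed
  show ?thesis
    unfolding P_def[symmetric]
    by (rule power2_le_imp_le) (use P in \<open>simp_all add: power_mult_distrib\<close>)
qed

text \<open>If \<open>h\<close> is integrable, the bound is the integrated pointwise one combined
  with Cauchy-Schwarz. Otherwise the integral is 0 by convention and the bound is trivial, so a
  pointwise estimate of the integrand suffices in the applications.\<close>

lemma abs_integral_le_L2_norm:
  assumes f: "f \<in> L2 \<Omega>" and g: "g \<in> L2 \<Omega>" and c: "0 \<le> c"
    and ae: "AE x in lebesgue_on \<Omega>. \<bar>h x\<bar> \<le> c * (norm (f x) * norm (g x))"
  shows "\<bar>LINT x|lebesgue_on \<Omega>. h x\<bar> \<le> c * (L2_norm \<Omega> f * L2_norm \<Omega> g)"
proof (cases "integrable (lebesgue_on \<Omega>) h")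
  case True
  have "\<bar>LINT x|lebesgue_on \<Omega>. h x\<bar> \<le> (LINT x|lebesgue_on \<Omega>. \<bar>h x\<bar>)"
    by simp
  also have "\<dots> \<le> (LINT x|lebesgue_on \<Omega>. c * (norm (f x) * norm (g x)))"
    using True ae
    by (intro integral_mono_AE integrable_mult_right integrable_norm_mult_norm f g) auto
  also have "\<dots> \<le> c * (L2_norm \<Omega> f * L2_norm \<Omega> g)"
    using integral_norm_mult_norm_le[OF f g] c by (simp add: mult_left_mono)
  finally show ?thesis .
qed (use c in \<open>simp add: not_integrable_integral_eq\<close>)

lemma abs_L2_inner_le:
  assumes f: "f \<in> L2 \<Omega>" and g: "g \<in> L2 \<Omega>"
  shows "\<bar>L2_inner \<Omega> f g\<bar> \<le> L2_norm \<Omega> f * L2_norm \<Omega> g"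
  unfolding L2_inner_def
  using abs_integral_le_L2_norm[OF f g, of 1] by (simp add: Cauchy_Schwarz_ineq2)

text \<open>The squared norm of the sum is expanded. The mixed term is integrable and, by
  Cauchy-Schwarz, small enough to give the triangle inequality.\<close>

lemma L2_add:
  assumes f: "f \<in> L2 \<Omega>" and g: "g \<in> L2 \<Omega>"
  shows "(\<lambda>x. f x + g x) \<in> L2 \<Omega>" and "L2_norm \<Omega> (\<lambda>x. f x + g x) \<le> L2_norm \<Omega> f + L2_norm \<Omega> g"
proof -
  have eq: "(norm (f x + g x))\<^sup>2 = (norm (f x))\<^sup>2 + 2 * (f x \<bullet> g x) + (norm (g x))\<^sup>2" for x
    by (simp add: power2_norm_eq_inner inner_add inner_commute)
  note int = L2_integrable[OF f] L2_integrable[OF g] integrable_inner_L2[OF f g]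
  have "(\<lambda>x. f x + g x) \<in> borel_measurable (lebesgue_on \<Omega>)"
    using L2_measurable[OF f] L2_measurable[OF g] by measurable
  then show "(\<lambda>x. f x + g x) \<in> L2 \<Omega>"
    using int by (simp add: L2_def eq)
  have "(L2_norm \<Omega> (\<lambda>x. f x + g x))\<^sup>2 = (L2_norm \<Omega> f)\<^sup>2 + 2 * L2_inner \<Omega> f g + (L2_norm \<Omega> g)\<^sup>2"
    using int by (simp add: L2_norm_sq eq L2_inner_def)
  also have "\<dots> \<le> (L2_norm \<Omega> f + L2_norm \<Omega> g)\<^sup>2"
    using abs_L2_inner_le[OF f g] by (simp add: power2_sum)
  finally show "L2_norm \<Omega> (\<lambda>x. f x + g x) \<le> L2_norm \<Omega> f + L2_norm \<Omega> g"
    by (rule power2_le_imp_le) simp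
qed

lemma L2_diff:
  assumes f: "f \<in> L2 \<Omega>" and g: "g \<in> L2 \<Omega>"
  shows "(\<lambda>x. f x - g x) \<in> L2 \<Omega>" and "L2_norm \<Omega> (\<lambda>x. f x - g x) \<le> L2_norm \<Omega> f + L2_norm \<Omega> g"
proof -
  have "(\<lambda>x. - g x) \<in> L2 \<Omega>" "L2_norm \<Omega> (\<lambda>x. - g x) = L2_norm \<Omega> g"
    using g by (auto simp: L2_def L2_norm_def)
  with L2_add[OF f this(1)] show "(\<lambda>x. f x - g x) \<in> L2 \<Omega>"
    "L2_norm \<Omega> (\<lambda>x. f x - g x) \<le> L2_norm \<Omega> f + L2_norm \<Omega> g"
    by simp_all
qed

lemma L2_inner_diff_left:
  assumes "f \<in> L2 \<Omega>" "g \<in> L2 \<Omega>" "h \<in> L2 \<Omega>"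
  shows "L2_inner \<Omega> (\<lambda>x. f x - g x) h = L2_inner \<Omega> f h - L2_inner \<Omega> g h"
  using assms by (simp add: L2_inner_def inner_diff_left integrable_inner_L2)

section \<open>Chosen weak derivatives and their square integrability\<close>

lemma has_weak_grad_weak_grad: "v \<in> H1 \<Omega> \<Longrightarrow> has_weak_grad \<Omega> v (weak_grad \<Omega> v)"
  using someI_ex[of "has_weak_grad \<Omega> v"] by (simp add: H1_def weak_grad_def)

lemma has_weak_div_weak_div: "\<tau> \<in> Hdiv \<Omega> \<Longrightarrow> has_weak_div \<Omega> \<tau> (weak_div \<Omega> \<tau>)"
  using someI_ex[of "has_weak_div \<Omega> \<tau>"] by (simp add: Hdiv_def weak_div_def)

lemma H1_D_L2:
  assumes "v \<in> H1_D \<Omega> \<Gamma>"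
  shows "v \<in> L2 \<Omega>" "weak_grad \<Omega> v \<in> L2 \<Omega>"
  using assms has_weak_grad_weak_grad[of v \<Omega>] by (auto simp: H1_D_def has_weak_grad_def)

lemma H_N_div_L2:
  assumes "\<tau> \<in> H_N_div \<Omega> \<Gamma>"
  shows "\<tau> \<in> L2 \<Omega>" "weak_div \<Omega> \<tau> \<in> L2 \<Omega>"
  using assms has_weak_div_weak_div[of \<tau> \<Omega>] by (auto simp: H_N_div_def has_weak_div_def)

text \<open>The remaining summands under the root are nonnegative. In this form the a priori
  estimate enters the duality argument.\<close>

lemma L2_norms_le_H2_norm:
  shows "L2_norm \<Omega> u \<le> H2_norm \<Omega> u" and "L2_norm \<Omega> (weak_grad \<Omega> u) \<le> H2_norm \<Omega> u"
  unfolding H2_norm_def by (intro real_le_rsqrt; simp add: sum_nonneg)+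

section \<open>The least-squares form\<close>

text \<open>The bounds are parameters alongside the coefficients, so every constant below can be
  written in terms of the bounds alone. \<open>A_spd\<close> makes the pointwise matrix results
  available almost everywhere.\<close>

locale elliptic_coeffs =
  fixes \<Omega> :: "(real^'n) set" and \<Lambda>\<^sub>0 \<Lambda>\<^sub>1 \<beta> a\<^sub>0 a\<^sub>1 :: real
    and A :: "real^'n \<Rightarrow> real^'n^'n" and b :: "real^'n \<Rightarrow> real^'n" and a :: "real^'n \<Rightarrow> real"
  assumes lebesgue_\<Omega>: "\<Omega> \<in> sets lebesgue"
    and \<Lambda>\<^sub>0_pos: "0 < \<Lambda>\<^sub>0" and \<Lambda>\<^sub>0_le: "\<Lambda>\<^sub>0 \<le> \<Lambda>\<^sub>1" and \<beta>_nonneg: "0 \<le> \<beta>"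
    and a\<^sub>0_pos: "0 < a\<^sub>0" and a\<^sub>0_le: "a\<^sub>0 \<le> a\<^sub>1"
    and A_measurable [measurable]: "A \<in> borel_measurable (lebesgue_on \<Omega>)"
    and b_measurable [measurable]: "b \<in> borel_measurable (lebesgue_on \<Omega>)"
    and a_measurable [measurable]: "a \<in> borel_measurable (lebesgue_on \<Omega>)"
    and A_spd: "AE x in lebesgue_on \<Omega>. spd_matrix (A x) \<Lambda>\<^sub>0 \<Lambda>\<^sub>1"
    and b_bound: "AE x in lebesgue_on \<Omega>. norm (b x) \<le> \<beta>"
    and a_bounds: "AE x in lebesgue_on \<Omega>. a\<^sub>0 \<le> a x \<and> a x \<le> a\<^sub>1"
begin

lemma \<Lambda>\<^sub>1_pos: "0 < \<Lambda>\<^sub>1" and a\<^sub>1_pos: "0 < a\<^sub>1"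
  using \<Lambda>\<^sub>0_pos \<Lambda>\<^sub>0_le a\<^sub>0_pos a\<^sub>0_le by linarith+

definition flux_residual :: "(real^'n \<Rightarrow> real^'n) \<Rightarrow> (real^'n \<Rightarrow> real) \<Rightarrow> real^'n \<Rightarrow> real^'n" where
  "flux_residual \<tau> v = (\<lambda>x. \<tau> x - (A x *v weak_grad \<Omega> v x + v x *\<^sub>R b x))"

text \<open>This is the second factor of the second product in \<open>ls_form\<close>. The first
  factor there is the same expression divided by \<open>a\<close>.\<close>

definition div_residual :: "(real^'n \<Rightarrow> real^'n) \<Rightarrow> (real^'n \<Rightarrow> real) \<Rightarrow> real^'n \<Rightarrow> real" where
  "div_residual \<tau> v = (\<lambda>x. weak_div \<Omega> \<tau> x - a x * v x)"

section \<open>Multiplication by the coefficients and the residuals in L2\<close>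

lemma A_mult_L2:
  assumes "f \<in> L2 \<Omega>"
  shows "(\<lambda>x. A x *v f x) \<in> L2 \<Omega>" and "L2_norm \<Omega> (\<lambda>x. A x *v f x) \<le> \<Lambda>\<^sub>1 * L2_norm \<Omega> f"
proof -
  note [measurable] = L2_measurable[OF assms]
  have m: "(\<lambda>x. A x *v f x) \<in> borel_measurable (lebesgue_on \<Omega>)"
    by measurable
  have "AE x in lebesgue_on \<Omega>. norm (A x *v f x) \<le> \<Lambda>\<^sub>1 * norm (f x)"
    using A_spd by eventually_elim (rule spd_matrix.norm_mult_le)
  from L2_bound[OF assms m less_imp_le[OF \<Lambda>\<^sub>1_pos] this]
  show "(\<lambda>x. A x *v f x) \<in> L2 \<Omega>" "L2_norm \<Omega> (\<lambda>x. A x *v f x) \<le> \<Lambda>\<^sub>1 * L2_norm \<Omega> f" .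
qed

lemma scaleR_b_L2:
  assumes "v \<in> L2 \<Omega>"
  shows "(\<lambda>x. v x *\<^sub>R b x) \<in> L2 \<Omega>" and "L2_norm \<Omega> (\<lambda>x. v x *\<^sub>R b x) \<le> \<beta> * L2_norm \<Omega> v"
proof -
  note [measurable] = L2_measurable[OF assms]
  have m: "(\<lambda>x. v x *\<^sub>R b x) \<in> borel_measurable (lebesgue_on \<Omega>)"
    by measurable
  have "AE x in lebesgue_on \<Omega>. norm (v x *\<^sub>R b x) \<le> \<beta> * norm (v x)"
    using b_bound by eventually_elim (simp add: mult.commute[of \<beta>] mult_left_mono)
  from L2_bound[OF assms m \<beta>_nonneg this]
  show "(\<lambda>x. v x *\<^sub>R b x) \<in> L2 \<Omega>" "L2_norm \<Omega> (\<lambda>x. v x *\<^sub>R b x) \<le> \<beta> * L2_norm \<Omega> v" .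
qed

lemma a_mult_L2:
  assumes "v \<in> L2 \<Omega>"
  shows "(\<lambda>x. a x * v x) \<in> L2 \<Omega>" and "L2_norm \<Omega> (\<lambda>x. a x * v x) \<le> a\<^sub>1 * L2_norm \<Omega> v"
proof -
  note [measurable] = L2_measurable[OF assms]
  have m: "(\<lambda>x. a x * v x) \<in> borel_measurable (lebesgue_on \<Omega>)"
    by measurable
  have "AE x in lebesgue_on \<Omega>. norm (a x * v x) \<le> a\<^sub>1 * norm (v x)"
    using a_bounds
  proof eventually_elim
    case (elim x)
    with a\<^sub>0_pos have "\<bar>a x\<bar> \<le> a\<^sub>1" by linarith
    then show ?case by (simp add: abs_mult mult_right_mono)
  qed
  from L2_bound[OF assms m less_imp_le[OF a\<^sub>1_pos] this]
  show "(\<lambda>x. a x * v x) \<in> L2 \<Omega>" "L2_norm \<Omega> (\<lambda>x. a x * v x) \<le> a\<^sub>1 * L2_norm \<Omega> v" .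
qed

lemma b_inner_L2:
  assumes "f \<in> L2 \<Omega>"
  shows "(\<lambda>x. b x \<bullet> f x) \<in> L2 \<Omega>"
proof (rule L2_bound(1)[OF assms _ \<beta>_nonneg])
  note [measurable] = L2_measurable[OF assms]
  show "(\<lambda>x. b x \<bullet> f x) \<in> borel_measurable (lebesgue_on \<Omega>)" by measurable
  show "AE x in lebesgue_on \<Omega>. norm (b x \<bullet> f x) \<le> \<beta> * norm (f x)"
    using b_bound
    by eventually_elim
      (auto intro: order_trans[OF Cauchy_Schwarz_ineq2] simp: mult_right_mono)
qed

lemma A_inv_measurable:
  assumes "f \<in> borel_measurable (lebesgue_on \<Omega>)"
  shows "(\<lambda>x. matrix_inv (A x) *v f x) \<in> borel_measurable (lebesgue_on \<Omega>)"
proof (rule borel_measurable_matrix_inv_mult[OF lebesgue_\<Omega> A_measurable assms])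
  show "AE x in lebesgue_on \<Omega>. invertible (A x)"
    using A_spd by eventually_elim (rule spd_matrix.invertible)
qed

lemma flux_residual_L2:
  assumes "\<tau> \<in> L2 \<Omega>" "v \<in> L2 \<Omega>" "weak_grad \<Omega> v \<in> L2 \<Omega>"
  shows "flux_residual \<tau> v \<in> L2 \<Omega>"
    and "L2_norm \<Omega> (flux_residual \<tau> v) \<le>
      L2_norm \<Omega> \<tau> + \<Lambda>\<^sub>1 * L2_norm \<Omega> (weak_grad \<Omega> v) + \<beta> * L2_norm \<Omega> v"
proof -
  note s = L2_add[OF A_mult_L2(1)[OF assms(3)] scaleR_b_L2(1)[OF assms(2)]]
  show "flux_residual \<tau> v \<in> L2 \<Omega>"
    unfolding flux_residual_def by (rule L2_diff(1)[OF assms(1) s(1)])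
  show "L2_norm \<Omega> (flux_residual \<tau> v) \<le>
      L2_norm \<Omega> \<tau> + \<Lambda>\<^sub>1 * L2_norm \<Omega> (weak_grad \<Omega> v) + \<beta> * L2_norm \<Omega> v"
    unfolding flux_residual_def
    using L2_diff(2)[OF assms(1) s(1)] s(2) A_mult_L2(2)[OF assms(3)] scaleR_b_L2(2)[OF assms(2)]
    by linarith
qed

lemma div_residual_L2:
  assumes "weak_div \<Omega> \<tau> \<in> L2 \<Omega>" "v \<in> L2 \<Omega>"
  shows "div_residual \<tau> v \<in> L2 \<Omega>"
    and "L2_norm \<Omega> (div_residual \<tau> v) \<le> L2_norm \<Omega> (weak_div \<Omega> \<tau>) + a\<^sub>1 * L2_norm \<Omega> v"
proof -
  note d = L2_diff[OF assms(1) a_mult_L2(1)[OF assms(2)]]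
  show "div_residual \<tau> v \<in> L2 \<Omega>"
    unfolding div_residual_def by (rule d(1))
  show "L2_norm \<Omega> (div_residual \<tau> v) \<le> L2_norm \<Omega> (weak_div \<Omega> \<tau>) + a\<^sub>1 * L2_norm \<Omega> v"
    unfolding div_residual_def using d(2) a_mult_L2(2)[OF assms(2)] by linarith
qed

text \<open>The definition of the residual is solved for \<tau>, followed by the triangle
  inequality. This recovers the flux once \<open>v\<close> and its gradient are controlled.\<close>

lemma flux_le:
  assumes "\<tau> \<in> L2 \<Omega>" "v \<in> L2 \<Omega>" "weak_grad \<Omega> v \<in> L2 \<Omega>"
  shows "L2_norm \<Omega> \<tau> \<le>
    L2_norm \<Omega> (flux_residual \<tau> v) + \<Lambda>\<^sub>1 * L2_norm \<Omega> (weak_grad \<Omega> v) + \<beta> * L2_norm \<Omega> v"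
proof -
  note s = L2_add[OF A_mult_L2(1)[OF assms(3)] scaleR_b_L2(1)[OF assms(2)]]
  have "\<tau> = (\<lambda>x. flux_residual \<tau> v x + (A x *v weak_grad \<Omega> v x + v x *\<^sub>R b x))"
    by (simp add: flux_residual_def)
  then have "L2_norm \<Omega> \<tau> =
      L2_norm \<Omega> (\<lambda>x. flux_residual \<tau> v x + (A x *v weak_grad \<Omega> v x + v x *\<^sub>R b x))"
    by (rule arg_cong)
  then show ?thesis
    using L2_add(2)[OF flux_residual_L2(1)[OF assms] s(1)] s(2) A_mult_L2(2)[OF assms(3)]
      scaleR_b_L2(2)[OF assms(2)] by linarith
qed

lemma div_le:
  assumes "weak_div \<Omega> \<tau> \<in> L2 \<Omega>" "v \<in> L2 \<Omega>"
  shows "L2_norm \<Omega> (weak_div \<Omega> \<tau>) \<le> L2_norm \<Omega> (div_residual \<tau> v) + a\<^sub>1 * L2_norm \<Omega> v"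
proof -
  have "weak_div \<Omega> \<tau> = (\<lambda>x. div_residual \<tau> v x + a x * v x)"
    by (simp add: div_residual_def)
  then have "L2_norm \<Omega> (weak_div \<Omega> \<tau>) = L2_norm \<Omega> (\<lambda>x. div_residual \<tau> v x + a x * v x)"
    by (rule arg_cong)
  then show ?thesis
    using L2_add(2)[OF div_residual_L2(1)[OF assms] a_mult_L2(1)[OF assms(2)]]
      a_mult_L2(2)[OF assms(2)] by linarith
qed

section \<open>Comparison of the energy norm with unweighted norms\<close>

lemma energy_norm_sq:
  "(energy_norm \<Omega> A a (\<tau>, v))\<^sup>2 = (L2_norm \<Omega> (\<lambda>x. sqrt (a x) * v x))\<^sup>2 +
     (L2_norm \<Omega> (\<lambda>x. matrix_sqrt (A x) *v weak_grad \<Omega> v x))\<^sup>2 +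
     (L2_norm \<Omega> (\<lambda>x. matrix_inv (matrix_sqrt (A x)) *v \<tau> x))\<^sup>2 +
     (L2_norm \<Omega> (\<lambda>x. inverse (sqrt (a x)) * weak_div \<Omega> \<tau> x))\<^sup>2"
  by (simp add: energy_norm_def)

lemma energy_norm_nonneg [simp]: "0 \<le> energy_norm \<Omega> A a p"
  by (simp add: energy_norm_def split_beta)

text \<open>The squared integrands are the quadratic forms of \<open>a\<close>, of \<open>A\<close>
  and of their inverses, which lie between constant multiples of the squared unweighted norms at
  almost every point.\<close>

lemma energy_norm_terms:
  assumes \<tau>: "\<tau> \<in> L2 \<Omega>" and D: "D \<in> L2 \<Omega>" and v: "v \<in> L2 \<Omega>" and G: "G \<in> L2 \<Omega>"
  shows "a\<^sub>0 * (L2_norm \<Omega> v)\<^sup>2 \<le> (L2_norm \<Omega> (\<lambda>x. sqrt (a x) * v x))\<^sup>2 \<and>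
      (L2_norm \<Omega> (\<lambda>x. sqrt (a x) * v x))\<^sup>2 \<le> a\<^sub>1 * (L2_norm \<Omega> v)\<^sup>2" (is ?v)
    and "\<Lambda>\<^sub>0 * (L2_norm \<Omega> G)\<^sup>2 \<le> (L2_norm \<Omega> (\<lambda>x. matrix_sqrt (A x) *v G x))\<^sup>2 \<and>
      (L2_norm \<Omega> (\<lambda>x. matrix_sqrt (A x) *v G x))\<^sup>2 \<le> \<Lambda>\<^sub>1 * (L2_norm \<Omega> G)\<^sup>2" (is ?G)
    and "(1 / \<Lambda>\<^sub>1) * (L2_norm \<Omega> \<tau>)\<^sup>2 \<le> (L2_norm \<Omega> (\<lambda>x. matrix_inv (matrix_sqrt (A x)) *v \<tau> x))\<^sup>2 \<and>
      (L2_norm \<Omega> (\<lambda>x. matrix_inv (matrix_sqrt (A x)) *v \<tau> x))\<^sup>2 \<le> (1 / \<Lambda>\<^sub>0) * (L2_norm \<Omega> \<tau>)\<^sup>2" (is ?\<tau>)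
    and "(1 / a\<^sub>1) * (L2_norm \<Omega> D)\<^sup>2 \<le> (L2_norm \<Omega> (\<lambda>x. inverse (sqrt (a x)) * D x))\<^sup>2 \<and>
      (L2_norm \<Omega> (\<lambda>x. inverse (sqrt (a x)) * D x))\<^sup>2 \<le> (1 / a\<^sub>0) * (L2_norm \<Omega> D)\<^sup>2" (is ?D)
proof -
  note [measurable] = L2_measurable[OF \<tau>] L2_measurable[OF D] L2_measurable[OF v] L2_measurable[OF G]
  show ?v
  proof -
    have m: "(\<lambda>x. (norm (sqrt (a x) * v x))\<^sup>2) \<in> borel_measurable (lebesgue_on \<Omega>)"
      by measurable
    have "AE x in lebesgue_on \<Omega>. a\<^sub>0 * (norm (v x))\<^sup>2 \<le> (norm (sqrt (a x) * v x))\<^sup>2 \<and>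
        (norm (sqrt (a x) * v x))\<^sup>2 \<le> a\<^sub>1 * (norm (v x))\<^sup>2"
      using a_bounds
      by eventually_elim (use a\<^sub>0_pos in \<open>auto simp: power_mult_distrib intro!: mult_right_mono\<close>)
    from integral_bounds_L2[OF v m less_imp_le[OF a\<^sub>0_pos] this] show ?thesis
      by (simp only: L2_norm_sq simp_thms)
  qed
  show ?D
  proof -
    have m: "(\<lambda>x. (norm (inverse (sqrt (a x)) * D x))\<^sup>2) \<in> borel_measurable (lebesgue_on \<Omega>)"
      by measurable
    have "AE x in lebesgue_on \<Omega>. (1 / a\<^sub>1) * (norm (D x))\<^sup>2 \<le> (norm (inverse (sqrt (a x)) * D x))\<^sup>2 \<and>
        (norm (inverse (sqrt (a x)) * D x))\<^sup>2 \<le> (1 / a\<^sub>0) * (norm (D x))\<^sup>2"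
      using a_bounds
    proof eventually_elim
      case (elim x)
      have "(norm (inverse (sqrt (a x)) * D x))\<^sup>2 = (1 / a x) * (norm (D x))\<^sup>2"
        using elim a\<^sub>0_pos by (simp add: power_mult_distrib power_inverse divide_inverse)
      moreover have "1 / a\<^sub>1 \<le> 1 / a x" "1 / a x \<le> 1 / a\<^sub>0"
        using elim a\<^sub>0_pos by (auto simp: frac_le)
      ultimately show ?case by (metis mult_right_mono zero_le_power2)
    qed
    from integral_bounds_L2[OF D m _ this] a\<^sub>1_pos show ?thesis
      by (simp only: L2_norm_sq simp_thms) simp
  qed
  show ?G
  proof -
    \<comment> \<open>\<open>matrix_sqrt\<close> is a choice made separately at each point, so
      measurability is taken from the equal quadratic form of \<open>A\<close>.\<close>
    have m: "(\<lambda>x. (norm (matrix_sqrt (A x) *v G x))\<^sup>2) \<in> borel_measurable (lebesgue_on \<Omega>)"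
    proof (rule borel_measurable_lebesgue_on_AE[OF lebesgue_\<Omega>])
      show "(\<lambda>x. G x \<bullet> (A x *v G x)) \<in> borel_measurable (lebesgue_on \<Omega>)"
        by measurable
      show "AE x in lebesgue_on \<Omega>. G x \<bullet> (A x *v G x) = (norm (matrix_sqrt (A x) *v G x))\<^sup>2"
        using A_spd by eventually_elim (simp add: spd_matrix.norm_matrix_sqrt_mult)
    qed
    have "AE x in lebesgue_on \<Omega>. \<Lambda>\<^sub>0 * (norm (G x))\<^sup>2 \<le> (norm (matrix_sqrt (A x) *v G x))\<^sup>2 \<and>
        (norm (matrix_sqrt (A x) *v G x))\<^sup>2 \<le> \<Lambda>\<^sub>1 * (norm (G x))\<^sup>2"
      using A_spd
      by eventually_elim (simp add: spd_matrix.norm_matrix_sqrt_mult spd_matrix.lower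
          spd_matrix.upper power2_norm_eq_inner[of "G _"])
    from integral_bounds_L2[OF G m less_imp_le[OF \<Lambda>\<^sub>0_pos] this] show ?thesis
      by (simp only: L2_norm_sq simp_thms)
  qed
  show ?\<tau>
  proof -
    have m: "(\<lambda>x. (norm (matrix_inv (matrix_sqrt (A x)) *v \<tau> x))\<^sup>2)
        \<in> borel_measurable (lebesgue_on \<Omega>)"
    proof (rule borel_measurable_lebesgue_on_AE[OF lebesgue_\<Omega>])
      note [measurable] = A_inv_measurable[OF L2_measurable[OF \<tau>]]
      show "(\<lambda>x. \<tau> x \<bullet> (matrix_inv (A x) *v \<tau> x)) \<in> borel_measurable (lebesgue_on \<Omega>)"
        by measurable
      show "AE x in lebesgue_on \<Omega>. \<tau> x \<bullet> (matrix_inv (A x) *v \<tau> x) =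
          (norm (matrix_inv (matrix_sqrt (A x)) *v \<tau> x))\<^sup>2"
        using A_spd by eventually_elim (simp add: spd_matrix.norm_inv_matrix_sqrt_mult)
    qed
    have "AE x in lebesgue_on \<Omega>.
        (1 / \<Lambda>\<^sub>1) * (norm (\<tau> x))\<^sup>2 \<le> (norm (matrix_inv (matrix_sqrt (A x)) *v \<tau> x))\<^sup>2 \<and>
        (norm (matrix_inv (matrix_sqrt (A x)) *v \<tau> x))\<^sup>2 \<le> (1 / \<Lambda>\<^sub>0) * (norm (\<tau> x))\<^sup>2"
      using A_spd
    proof eventually_elim
      case (elim x)
      then show ?case
        unfolding spd_matrix.norm_inv_matrix_sqrt_mult[OF elim]
        by (intro conjI spd_matrix.inner_inv_mult_ge spd_matrix.inner_inv_mult_le)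
    qed
    from integral_bounds_L2[OF \<tau> m _ this] \<Lambda>\<^sub>1_pos show ?thesis
      by (simp only: L2_norm_sq simp_thms) simp
  qed
qed

lemma energy_norm_sq_le:
  assumes "\<tau> \<in> L2 \<Omega>" "weak_div \<Omega> \<tau> \<in> L2 \<Omega>" "v \<in> L2 \<Omega>" "weak_grad \<Omega> v \<in> L2 \<Omega>"
  shows "(energy_norm \<Omega> A a (\<tau>, v))\<^sup>2 \<le> a\<^sub>1 * (L2_norm \<Omega> v)\<^sup>2 + \<Lambda>\<^sub>1 * (L2_norm \<Omega> (weak_grad \<Omega> v))\<^sup>2 +
    (1 / \<Lambda>\<^sub>0) * (L2_norm \<Omega> \<tau>)\<^sup>2 + (1 / a\<^sub>0) * (L2_norm \<Omega> (weak_div \<Omega> \<tau>))\<^sup>2"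
  using energy_norm_terms[OF assms] unfolding energy_norm_sq by linarith

lemma L2_norms_le_energy_norm:
  assumes "\<tau> \<in> L2 \<Omega>" "weak_div \<Omega> \<tau> \<in> L2 \<Omega>" "v \<in> L2 \<Omega>" "weak_grad \<Omega> v \<in> L2 \<Omega>"
  defines "E \<equiv> energy_norm \<Omega> A a (\<tau>, v)"
  shows "L2_norm \<Omega> v \<le> sqrt (1 / a\<^sub>0) * E" "L2_norm \<Omega> (weak_grad \<Omega> v) \<le> sqrt (1 / \<Lambda>\<^sub>0) * E"
    "L2_norm \<Omega> \<tau> \<le> sqrt \<Lambda>\<^sub>1 * E" "L2_norm \<Omega> (weak_div \<Omega> \<tau>) \<le> sqrt a\<^sub>1 * E"
proof -
  \<comment> \<open>Used with \<open>c\<close> equal to \<open>a\<^sub>0\<close>,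
    \<open>\<Lambda>\<^sub>0\<close>, \<open>1 / \<Lambda>\<^sub>1\<close> and
    \<open>1 / a\<^sub>1\<close>. In the last two cases the double reciprocal collapses.\<close>
  have le: "s \<le> sqrt (1 / c) * E" if "c * s\<^sup>2 \<le> E\<^sup>2" "0 < c" for s c
  proof (rule power2_le_imp_le)
    show "s\<^sup>2 \<le> (sqrt (1 / c) * E)\<^sup>2"
      using that by (simp add: power_mult_distrib field_simps)
    show "0 \<le> sqrt (1 / c) * E"
      using that by (simp add: E_def)
  qed
  note t = energy_norm_terms[OF assms(1-4)]
  have E: "E\<^sup>2 = (energy_norm \<Omega> A a (\<tau>, v))\<^sup>2" by (simp add: E_def)
  have nn: "0 \<le> (L2_norm \<Omega> (\<lambda>x. sqrt (a x) * v x))\<^sup>2"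
     "0 \<le> (L2_norm \<Omega> (\<lambda>x. matrix_sqrt (A x) *v weak_grad \<Omega> v x))\<^sup>2"
     "0 \<le> (L2_norm \<Omega> (\<lambda>x. matrix_inv (matrix_sqrt (A x)) *v \<tau> x))\<^sup>2"
     "0 \<le> (L2_norm \<Omega> (\<lambda>x. inverse (sqrt (a x)) * weak_div \<Omega> \<tau> x))\<^sup>2"
    by simp_all
  have "a\<^sub>0 * (L2_norm \<Omega> v)\<^sup>2 \<le> E\<^sup>2" "\<Lambda>\<^sub>0 * (L2_norm \<Omega> (weak_grad \<Omega> v))\<^sup>2 \<le> E\<^sup>2"
    "(1 / \<Lambda>\<^sub>1) * (L2_norm \<Omega> \<tau>)\<^sup>2 \<le> E\<^sup>2" "(1 / a\<^sub>1) * (L2_norm \<Omega> (weak_div \<Omega> \<tau>))\<^sup>2 \<le> E\<^sup>2"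
    using t nn unfolding E energy_norm_sq by linarith+
  from this[THEN le]
  show "L2_norm \<Omega> v \<le> sqrt (1 / a\<^sub>0) * E" "L2_norm \<Omega> (weak_grad \<Omega> v) \<le> sqrt (1 / \<Lambda>\<^sub>0) * E"
    "L2_norm \<Omega> \<tau> \<le> sqrt \<Lambda>\<^sub>1 * E" "L2_norm \<Omega> (weak_div \<Omega> \<tau>) \<le> sqrt a\<^sub>1 * E"
    using a\<^sub>0_pos \<Lambda>\<^sub>0_pos a\<^sub>1_pos \<Lambda>\<^sub>1_pos by simp_all
qed

section \<open>Bounds of the form in terms of the residuals\<close>

text \<open>Invertibility of \<open>A x\<close> and positivity of \<open>a x\<close> hold almost
  everywhere. There the remaining factors of the form are the residuals multiplied by the inverses
  of \<open>A\<close> and \<open>a\<close>.\<close>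

lemma ls_form_factors:
  "AE x in lebesgue_on \<Omega>. matrix_inv (A x) *v \<tau> x - (weak_grad \<Omega> v x + v x *\<^sub>R (matrix_inv (A x) *v b x))
     = matrix_inv (A x) *v flux_residual \<tau> v x"
  "AE x in lebesgue_on \<Omega>. (inverse (a x) * weak_div \<Omega> \<eta> x - w x) = inverse (a x) * div_residual \<eta> w x"
proof -
  show "AE x in lebesgue_on \<Omega>. matrix_inv (A x) *v \<tau> x - (weak_grad \<Omega> v x + v x *\<^sub>R (matrix_inv (A x) *v b x))
     = matrix_inv (A x) *v flux_residual \<tau> v x"
    using A_spd
    by eventually_elim (simp add: flux_residual_def matrix_vector_mult_diff_distrib
        matrix_vector_right_distrib matrix_vector_mult_scaleR spd_matrix.inv_mult)
  show "AE x in lebesgue_on \<Omega>. (inverse (a x) * weak_div \<Omega> \<eta> x - w x) = inverse (a x) * div_residual \<eta> w x"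
    using a_bounds by eventually_elim (use a\<^sub>0_pos in \<open>simp add: div_residual_def field_simps\<close>)
qed

text \<open>Cauchy-Schwarz, with the inverses of \<open>A\<close> and \<open>a\<close> bounded by
  \<open>1 / \<Lambda>\<^sub>0\<close> and \<open>1 / a\<^sub>0\<close>.\<close>

lemma ls_form_le:
  assumes \<eta>: "\<eta> \<in> L2 \<Omega>" "weak_div \<Omega> \<eta> \<in> L2 \<Omega>" and w: "w \<in> L2 \<Omega>" "weak_grad \<Omega> w \<in> L2 \<Omega>"
    and \<tau>: "\<tau> \<in> L2 \<Omega>" "weak_div \<Omega> \<tau> \<in> L2 \<Omega>" and v: "v \<in> L2 \<Omega>" "weak_grad \<Omega> v \<in> L2 \<Omega>"
  shows "ls_form \<Omega> A b a (\<eta>, w) (\<tau>, v) \<le>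
    (1 / \<Lambda>\<^sub>0) * (L2_norm \<Omega> (flux_residual \<eta> w) * L2_norm \<Omega> (flux_residual \<tau> v)) +
    (1 / a\<^sub>0) * (L2_norm \<Omega> (div_residual \<eta> w) * L2_norm \<Omega> (div_residual \<tau> v))"
proof -
  have "L2_inner \<Omega> (flux_residual \<eta> w)
      (\<lambda>x. matrix_inv (A x) *v \<tau> x - (weak_grad \<Omega> v x + v x *\<^sub>R (matrix_inv (A x) *v b x))) \<le>
    (1 / \<Lambda>\<^sub>0) * (L2_norm \<Omega> (flux_residual \<eta> w) * L2_norm \<Omega> (flux_residual \<tau> v))"
    unfolding L2_inner_def
  proof (rule order_trans[OF abs_ge_self], rule abs_integral_le_L2_norm)
    show "AE x in lebesgue_on \<Omega>. \<bar>flux_residual \<eta> w x \<bullet>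
        (matrix_inv (A x) *v \<tau> x - (weak_grad \<Omega> v x + v x *\<^sub>R (matrix_inv (A x) *v b x)))\<bar> \<le>
        (1 / \<Lambda>\<^sub>0) * (norm (flux_residual \<eta> w x) * norm (flux_residual \<tau> v x))"
      using A_spd ls_form_factors(1)[of \<tau> v]
    proof eventually_elim
      case (elim x)
      show ?case
        unfolding elim(2)
        using Cauchy_Schwarz_ineq2[of "flux_residual \<eta> w x" "matrix_inv (A x) *v flux_residual \<tau> v x"]
          mult_left_mono[OF spd_matrix.norm_inv_mult_le[OF elim(1), of "flux_residual \<tau> v x"]
            norm_ge_zero[of "flux_residual \<eta> w x"]]
        by (simp add: mult.left_commute)
    qed
  qed (use \<Lambda>\<^sub>0_pos flux_residual_L2(1) assms in auto)
  moreover have "L2_inner \<Omega> (\<lambda>x. inverse (a x) * weak_div \<Omega> \<eta> x - w x) (div_residual \<tau> v) \<le>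
    (1 / a\<^sub>0) * (L2_norm \<Omega> (div_residual \<eta> w) * L2_norm \<Omega> (div_residual \<tau> v))"
    unfolding L2_inner_def
  proof (rule order_trans[OF abs_ge_self], rule abs_integral_le_L2_norm)
    show "AE x in lebesgue_on \<Omega>. \<bar>(inverse (a x) * weak_div \<Omega> \<eta> x - w x) \<bullet> div_residual \<tau> v x\<bar> \<le>
        (1 / a\<^sub>0) * (norm (div_residual \<eta> w x) * norm (div_residual \<tau> v x))"
      using a_bounds ls_form_factors(2)[of \<eta> w]
    proof eventually_elim
      case (elim x)
      have "inverse (a x) \<le> 1 / a\<^sub>0" "0 < a x"
        using elim(1) a\<^sub>0_pos by (auto simp: inverse_eq_divide frac_le)
      then show ?case
        unfolding elim(2)
        using mult_right_mono[of "inverse (a x)" "1 / a\<^sub>0"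
            "\<bar>div_residual \<eta> w x\<bar> * \<bar>div_residual \<tau> v x\<bar>"]
        by (simp add: abs_mult mult.assoc)
    qed
  qed (use a\<^sub>0_pos div_residual_L2(1) assms in auto)
  ultimately show ?thesis
    by (simp add: ls_form_def flux_residual_def[symmetric] div_residual_def[symmetric])
qed

text \<open>On the diagonal both integrands are quadratic in the residuals, and the inverses of
  \<open>A\<close> and \<open>a\<close> are bounded below by \<open>1 / \<Lambda>\<^sub>1\<close>
  and \<open>1 / a\<^sub>1\<close>.\<close>

lemma ls_form_diag_ge:
  assumes \<tau>: "\<tau> \<in> L2 \<Omega>" "weak_div \<Omega> \<tau> \<in> L2 \<Omega>" and v: "v \<in> L2 \<Omega>" "weak_grad \<Omega> v \<in> L2 \<Omega>"
  shows "(1 / \<Lambda>\<^sub>1) * (L2_norm \<Omega> (flux_residual \<tau> v))\<^sup>2 + (1 / a\<^sub>1) * (L2_norm \<Omega> (div_residual \<tau> v))\<^sup>2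
    \<le> ls_form \<Omega> A b a (\<tau>, v) (\<tau>, v)"
proof -
  note r = flux_residual_L2(1)[OF \<tau>(1) v] and s = div_residual_L2(1)[OF \<tau>(2) v(1)]
  note [measurable] = L2_measurable[OF \<tau>(1)] L2_measurable[OF \<tau>(2)] L2_measurable[OF v(1)]
    L2_measurable[OF v(2)] L2_measurable[OF r] L2_measurable[OF s]
    A_inv_measurable[OF L2_measurable[OF \<tau>(1)]] A_inv_measurable[OF b_measurable]
  have "(1 / \<Lambda>\<^sub>1) * (L2_norm \<Omega> (flux_residual \<tau> v))\<^sup>2 \<le> L2_inner \<Omega> (flux_residual \<tau> v)
      (\<lambda>x. matrix_inv (A x) *v \<tau> x - (weak_grad \<Omega> v x + v x *\<^sub>R (matrix_inv (A x) *v b x)))"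
    unfolding L2_inner_def
  proof (rule integral_bounds_L2(2)[OF r])
    show "AE x in lebesgue_on \<Omega>. (1 / \<Lambda>\<^sub>1) * (norm (flux_residual \<tau> v x))\<^sup>2 \<le> flux_residual \<tau> v x \<bullet>
        (matrix_inv (A x) *v \<tau> x - (weak_grad \<Omega> v x + v x *\<^sub>R (matrix_inv (A x) *v b x))) \<and>
        flux_residual \<tau> v x \<bullet>
        (matrix_inv (A x) *v \<tau> x - (weak_grad \<Omega> v x + v x *\<^sub>R (matrix_inv (A x) *v b x))) \<le>
        (1 / \<Lambda>\<^sub>0) * (norm (flux_residual \<tau> v x))\<^sup>2"
      using A_spd ls_form_factors(1)[of \<tau> v]
    proof eventually_elim
      case (elim x)
      show ?case
        unfolding elim(2)
        by (intro conjI spd_matrix.inner_inv_mult_ge[OF elim(1)] spd_matrix.inner_inv_mult_le[OF elim(1)])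
    qed
  qed (use \<Lambda>\<^sub>1_pos in \<open>measurable, simp\<close>)
  moreover have "(1 / a\<^sub>1) * (L2_norm \<Omega> (div_residual \<tau> v))\<^sup>2 \<le>
      L2_inner \<Omega> (\<lambda>x. inverse (a x) * weak_div \<Omega> \<tau> x - v x) (div_residual \<tau> v)"
    unfolding L2_inner_def
  proof (rule integral_bounds_L2(2)[OF s])
    show "AE x in lebesgue_on \<Omega>. (1 / a\<^sub>1) * (norm (div_residual \<tau> v x))\<^sup>2 \<le>
        (inverse (a x) * weak_div \<Omega> \<tau> x - v x) \<bullet> div_residual \<tau> v x \<and>
        (inverse (a x) * weak_div \<Omega> \<tau> x - v x) \<bullet> div_residual \<tau> v x \<le>
        (1 / a\<^sub>0) * (norm (div_residual \<tau> v x))\<^sup>2"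
      using a_bounds ls_form_factors(2)[of \<tau> v]
    proof eventually_elim
      case (elim x)
      have "1 / a\<^sub>1 \<le> 1 / a x" "1 / a x \<le> 1 / a\<^sub>0"
        using elim(1) a\<^sub>0_pos by (auto simp: frac_le)
      moreover have "(inverse (a x) * div_residual \<tau> v x) \<bullet> div_residual \<tau> v x =
          (1 / a x) * (norm (div_residual \<tau> v x))\<^sup>2"
        by (simp add: power2_eq_square divide_inverse)
      ultimately show ?case
        unfolding elim(2) by (metis mult_right_mono zero_le_power2)
    qed
  qed (use a\<^sub>1_pos in \<open>measurable, simp\<close>)
  ultimately show ?thesis
    by (simp add: ls_form_def flux_residual_def[symmetric] div_residual_def[symmetric])
qed

section \<open>Control of v and its gradient by the residuals\<close>

text \<open>Green's formula moves the divergence of \<open>\<tau>\<close> onto the test function, without boundary terms.\<close>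

lemma residual_weak_form:
  assumes \<tau>: "\<tau> \<in> H_N_div \<Omega> \<Gamma>" and v: "v \<in> H1_D \<Omega> \<Gamma>" and \<phi>: "\<phi> \<in> H1_D \<Omega> \<Gamma>"
  shows "L2_inner \<Omega> (\<lambda>x. A x *v weak_grad \<Omega> v x + v x *\<^sub>R b x) (weak_grad \<Omega> \<phi>) +
      L2_inner \<Omega> (\<lambda>x. a x * v x) \<phi> =
    - L2_inner \<Omega> (flux_residual \<tau> v) (weak_grad \<Omega> \<phi>) - L2_inner \<Omega> (div_residual \<tau> v) \<phi>"
proof -
  note L2 = H_N_div_L2[OF \<tau>] H1_D_L2[OF v] H1_D_L2[OF \<phi>]
  have "normal_trace \<Omega> \<tau> \<phi> = 0"
    using \<tau> \<phi> by (simp add: H_N_div_def)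
  moreover have "L2_inner \<Omega> (flux_residual \<tau> v) (weak_grad \<Omega> \<phi>) =
      L2_inner \<Omega> \<tau> (weak_grad \<Omega> \<phi>) -
      L2_inner \<Omega> (\<lambda>x. A x *v weak_grad \<Omega> v x + v x *\<^sub>R b x) (weak_grad \<Omega> \<phi>)"
    unfolding flux_residual_def
    by (intro L2_inner_diff_left L2_add A_mult_L2 scaleR_b_L2 L2)
  moreover have "L2_inner \<Omega> (div_residual \<tau> v) \<phi> =
      L2_inner \<Omega> (weak_div \<Omega> \<tau>) \<phi> - L2_inner \<Omega> (\<lambda>x. a x * v x) \<phi>"
    unfolding div_residual_def by (intro L2_inner_diff_left a_mult_L2 L2)
  ultimately show ?thesis by (simp add: normal_trace_def)
qed

text \<open>Duality argument: test the weak form with the primal solution for the right-hand side \<open>v\<close>.\<close>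

lemma L2_norm_le_residuals:
  assumes \<tau>: "\<tau> \<in> H_N_div \<Omega> \<Gamma>" and v: "v \<in> H1_D \<Omega> \<Gamma>"
    and u: "primal_solution \<Omega> \<Gamma> A b a v u" and K: "H2_norm \<Omega> u \<le> K * L2_norm \<Omega> v" "0 \<le> K"
  shows "L2_norm \<Omega> v \<le> K * (L2_norm \<Omega> (flux_residual \<tau> v) + L2_norm \<Omega> (div_residual \<tau> v))"
proof -
  have u_D: "u \<in> H1_D \<Omega> \<Gamma>" using u by (simp add: primal_solution_def)
  note L2 = H_N_div_L2[OF \<tau>] H1_D_L2[OF v] H1_D_L2[OF u_D]
  note r = flux_residual_L2(1)[OF L2(1,3,4)] and s = div_residual_L2(1)[OF L2(2,3)]
  let ?R = "L2_norm \<Omega> (flux_residual \<tau> v)" and ?S = "L2_norm \<Omega> (div_residual \<tau> v)"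
    and ?V = "L2_norm \<Omega> v"
  have i1: "integrable (lebesgue_on \<Omega>) (\<lambda>x. (A x *v weak_grad \<Omega> u x) \<bullet> weak_grad \<Omega> v x)"
    and i2: "integrable (lebesgue_on \<Omega>) (\<lambda>x. (b x \<bullet> weak_grad \<Omega> u x + a x * u x) \<bullet> v x)"
    and i3: "integrable (lebesgue_on \<Omega>) (\<lambda>x. (A x *v weak_grad \<Omega> v x + v x *\<^sub>R b x) \<bullet> weak_grad \<Omega> u x)"
    and i4: "integrable (lebesgue_on \<Omega>) (\<lambda>x. (a x * v x) \<bullet> u x)"
    by (intro integrable_inner_L2 L2_add A_mult_L2 scaleR_b_L2 a_mult_L2 b_inner_L2 L2)+
  \<comment> \<open>Here \<open>v\<close> is both the right-hand side of the problem solved by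
    \<open>u\<close> and its test function.\<close>
  have "?V\<^sup>2 = L2_inner \<Omega> (\<lambda>x. A x *v weak_grad \<Omega> u x) (weak_grad \<Omega> v) +
        L2_inner \<Omega> (\<lambda>x. b x \<bullet> weak_grad \<Omega> u x + a x * u x) v"
    using u v by (simp add: primal_solution_def L2_inner_self)
  also have "\<dots> = (LINT x|lebesgue_on \<Omega>. (A x *v weak_grad \<Omega> u x) \<bullet> weak_grad \<Omega> v x +
      (b x \<bullet> weak_grad \<Omega> u x + a x * u x) \<bullet> v x)"
    unfolding L2_inner_def by (rule Bochner_Integration.integral_add[OF i1 i2, symmetric])
  \<comment> \<open>Symmetry of \<open>A\<close> exchanges the two gradients, and the factor
    \<open>v\<close> of the convection term moves onto \<open>b\<close>. Now \<open>u\<close>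
    appears as the test function in the weak form for \<open>v\<close>.\<close>
  also have "\<dots> = (LINT x|lebesgue_on \<Omega>.
      (A x *v weak_grad \<Omega> v x + v x *\<^sub>R b x) \<bullet> weak_grad \<Omega> u x + (a x * v x) \<bullet> u x)"
  proof (rule integral_cong_AE)
    show "AE x in lebesgue_on \<Omega>. (A x *v weak_grad \<Omega> u x) \<bullet> weak_grad \<Omega> v x +
        (b x \<bullet> weak_grad \<Omega> u x + a x * u x) \<bullet> v x =
        (A x *v weak_grad \<Omega> v x + v x *\<^sub>R b x) \<bullet> weak_grad \<Omega> u x + (a x * v x) \<bullet> u x"
      using A_spd
    proof eventually_elim
      case (elim x)
      have "(A x *v weak_grad \<Omega> u x) \<bullet> weak_grad \<Omega> v x = (A x *v weak_grad \<Omega> v x) \<bullet> weak_grad \<Omega> u x"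
        using spd_matrix.self_adjoint[OF elim] by (simp add: inner_commute)
      then show ?case by (simp add: inner_add_left algebra_simps)
    qed
  qed (use i1 i2 i3 i4 in \<open>auto intro!: borel_measurable_add dest: borel_measurable_integrable\<close>)
  also have "\<dots> = - L2_inner \<Omega> (flux_residual \<tau> v) (weak_grad \<Omega> u) - L2_inner \<Omega> (div_residual \<tau> v) u"
    unfolding residual_weak_form[OF \<tau> v u_D, symmetric] unfolding L2_inner_def
    by (rule Bochner_Integration.integral_add[OF i3 i4])
  also have "\<dots> \<le> ?R * L2_norm \<Omega> (weak_grad \<Omega> u) + ?S * L2_norm \<Omega> u"
    using abs_L2_inner_le[OF r L2(6)] abs_L2_inner_le[OF s L2(5)] by linarith
  \<comment> \<open>The a priori estimate bounds both norms of \<open>u\<close> by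
    \<open>K * ?V\<close>. One factor \<open>?V\<close> is then cancelled.\<close>
  also have "\<dots> \<le> ?R * (K * ?V) + ?S * (K * ?V)"
    using L2_norms_le_H2_norm[of \<Omega> u] K(1) by (intro add_mono mult_left_mono) auto
  finally have "?V * ?V \<le> (K * (?R + ?S)) * ?V"
    by (simp add: power2_eq_square algebra_simps)
  then show ?thesis
    using K(2) L2_norm_nonneg[of \<Omega> v]
    by (cases "?V = 0") (auto simp: mult_le_cancel_right)
qed

text \<open>Test the weak form with \<open>v\<close> itself.\<close>

lemma grad_norm_energy_estimate:
  assumes \<tau>: "\<tau> \<in> H_N_div \<Omega> \<Gamma>" and v: "v \<in> H1_D \<Omega> \<Gamma>"
  defines "V \<equiv> L2_norm \<Omega> v" and "G \<equiv> L2_norm \<Omega> (weak_grad \<Omega> v)"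
  shows "\<Lambda>\<^sub>0 * G\<^sup>2 \<le> \<beta> * V * G + L2_norm \<Omega> (flux_residual \<tau> v) * G + L2_norm \<Omega> (div_residual \<tau> v) * V"
proof -
  note L2 = H_N_div_L2[OF \<tau>] H1_D_L2[OF v]
  note r = flux_residual_L2(1)[OF L2(1,3,4)] and s = div_residual_L2(1)[OF L2(2,3)]
  note m [measurable] = L2_measurable[OF L2(3)] L2_measurable[OF L2(4)]
  have A: "\<Lambda>\<^sub>0 * G\<^sup>2 \<le> L2_inner \<Omega> (\<lambda>x. A x *v weak_grad \<Omega> v x) (weak_grad \<Omega> v)"
    unfolding L2_inner_def G_def
  proof (rule integral_bounds_L2(2)[OF L2(4)])
    show "AE x in lebesgue_on \<Omega>. \<Lambda>\<^sub>0 * (norm (weak_grad \<Omega> v x))\<^sup>2 \<le>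
        (A x *v weak_grad \<Omega> v x) \<bullet> weak_grad \<Omega> v x \<and>
        (A x *v weak_grad \<Omega> v x) \<bullet> weak_grad \<Omega> v x \<le> \<Lambda>\<^sub>1 * (norm (weak_grad \<Omega> v x))\<^sup>2"
      using A_spd
      by eventually_elim (simp add: power2_norm_eq_inner inner_commute[of "_ *v _"]
          spd_matrix.lower spd_matrix.upper)
  qed (use \<Lambda>\<^sub>0_pos in \<open>measurable, simp\<close>)
  \<comment> \<open>The zero-order term has a good sign and is dropped in the final
    estimate.\<close>
  have a: "0 \<le> L2_inner \<Omega> (\<lambda>x. a x * v x) v"
    unfolding L2_inner_def
  proof (rule integral_nonneg_AE)
    show "AE x in lebesgue_on \<Omega>. 0 \<le> (a x * v x) \<bullet> v x"
      using a_bounds by eventually_elim (use a\<^sub>0_pos in \<open>simp add: mult.assoc\<close>)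
  qed
  \<comment> \<open>The convection term has no sign and is only bounded. The factor \<open>V\<close>
    in it is why the bound on \<open>v\<close> has to come first.\<close>
  have b: "\<bar>L2_inner \<Omega> (\<lambda>x. v x *\<^sub>R b x) (weak_grad \<Omega> v)\<bar> \<le> \<beta> * V * G"
    using abs_L2_inner_le[OF scaleR_b_L2(1)[OF L2(3)] L2(4)]
      mult_right_mono[OF scaleR_b_L2(2)[OF L2(3)], of G]
    unfolding V_def G_def by simp
  have "L2_inner \<Omega> (\<lambda>x. A x *v weak_grad \<Omega> v x + v x *\<^sub>R b x) (weak_grad \<Omega> v) =
      L2_inner \<Omega> (\<lambda>x. A x *v weak_grad \<Omega> v x) (weak_grad \<Omega> v) +
      L2_inner \<Omega> (\<lambda>x. v x *\<^sub>R b x) (weak_grad \<Omega> v)"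
    unfolding L2_inner_def inner_add_left
    by (intro Bochner_Integration.integral_add integrable_inner_L2 A_mult_L2 scaleR_b_L2 L2)
  then show ?thesis
    using residual_weak_form[OF \<tau> v v] A a b abs_L2_inner_le[OF r L2(4)] abs_L2_inner_le[OF s L2(3)]
    unfolding V_def G_def by linarith
qed

end

text \<open>For \<open>x\<close> above \<open>q\<close>, replacing one factor \<open>q\<close> in
  the last term by \<open>x\<close> allows a factor \<open>x\<close> to be cancelled. The summand 1
  in the constant covers \<open>x\<close> at most \<open>q\<close>.\<close>

lemma quadratic_bound:
  fixes x :: real
  assumes "c * x\<^sup>2 \<le> p * q * x + r * q\<^sup>2" and "0 < c" and "0 \<le> p" "0 \<le> q" "0 \<le> r"
  shows "x \<le> (1 + (p + r) / c) * q"
proof (cases "x \<le> q")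
  case True
  moreover have "0 \<le> (p + r) / c * q" using assms by simp
  ultimately show ?thesis by (simp add: distrib_right)
next
  case False
  then have x: "0 < x" "q \<le> x" using \<open>0 \<le> q\<close> by auto
  have "r * (q * q) \<le> r * (q * x)"
    using x assms by (intro mult_left_mono) auto
  then have "(c * x) * x \<le> ((p + r) * q) * x"
    using assms(1) by (simp add: power2_eq_square algebra_simps)
  then have "c * x \<le> (p + r) * q" using x by simp
  then have "x \<le> (p + r) / c * q" using \<open>0 < c\<close> by (simp add: field_simps)
  then show ?thesis using \<open>0 \<le> q\<close> by (simp add: distrib_right)
qed

section \<open>Coercivity and continuity of the form\<close>

context elliptic_coeffs
begin

text \<open>All four unweighted norms are bounded by multiples of the sum \<open>Q\<close> of the
  residual norms; \<open>g\<close> is the multiple for the gradient. \<open>m\<close> is the sum of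
  the squared multiples with the weights of \<open>energy_norm_sq_le\<close>, and the factor 2 comes
  from bounding the square of a sum by twice the sum of squares.\<close>

lemma ls_form_coercive:
  assumes \<tau>: "\<tau> \<in> H_N_div \<Omega> \<Gamma>" and v: "v \<in> H1_D \<Omega> \<Gamma>"
    and u: "primal_solution \<Omega> \<Gamma> A b a v u" and K: "H2_norm \<Omega> u \<le> K * L2_norm \<Omega> v" "0 \<le> K"
  defines "g \<equiv> 1 + (\<beta> * K + 1 + K) / \<Lambda>\<^sub>0"
  defines "m \<equiv> a\<^sub>1 * K\<^sup>2 + \<Lambda>\<^sub>1 * g\<^sup>2 + (1 / \<Lambda>\<^sub>0) * (1 + \<Lambda>\<^sub>1 * g + \<beta> * K)\<^sup>2 + (1 / a\<^sub>0) * (1 + a\<^sub>1 * K)\<^sup>2"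
  shows "(energy_norm \<Omega> A a (\<tau>, v))\<^sup>2 \<le> 2 * m * (\<Lambda>\<^sub>1 + a\<^sub>1) * ls_form \<Omega> A b a (\<tau>, v) (\<tau>, v)"
proof -
  note L2 = H_N_div_L2[OF \<tau>] H1_D_L2[OF v]
  define R where "R = L2_norm \<Omega> (flux_residual \<tau> v)"
  define S where "S = L2_norm \<Omega> (div_residual \<tau> v)"
  define V where "V = L2_norm \<Omega> v"
  define G where "G = L2_norm \<Omega> (weak_grad \<Omega> v)"
  define Q where "Q = R + S"
  note pos = \<Lambda>\<^sub>0_pos \<Lambda>\<^sub>1_pos a\<^sub>0_pos a\<^sub>1_pos \<beta>_nonneg K(2)
  have nn: "0 \<le> R" "0 \<le> S" "0 \<le> V" "0 \<le> G" "0 \<le> Q"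
    by (simp_all add: R_def S_def V_def G_def Q_def)
  have m: "0 \<le> m" using pos unfolding m_def by (intro add_nonneg_nonneg mult_nonneg_nonneg) auto
  have V: "V \<le> K * Q"
    using L2_norm_le_residuals[OF \<tau> v u K] by (simp add: V_def Q_def R_def S_def)
  have "\<Lambda>\<^sub>0 * G\<^sup>2 \<le> \<beta> * V * G + R * G + S * V"
    using grad_norm_energy_estimate[OF \<tau> v] by (simp add: V_def G_def R_def S_def)
  also have "\<dots> \<le> \<beta> * (K * Q) * G + Q * G + Q * (K * Q)"
    using V nn pos by (intro add_mono mult_mono) (auto simp: Q_def)
  also have "\<dots> = (\<beta> * K + 1) * Q * G + K * Q\<^sup>2"
    by (simp add: power2_eq_square algebra_simps)
  \<comment> \<open>With \<open>V\<close> eliminated, the inequality is quadratic in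
    \<open>G\<close> alone, and \<open>quadratic_bound\<close> returns exactly the constant
    \<open>g\<close>.\<close>
  finally have G: "G \<le> g * Q"
    using quadratic_bound[of \<Lambda>\<^sub>0 G "\<beta> * K + 1" Q K] pos nn by (simp add: g_def)
  have "L2_norm \<Omega> \<tau> \<le> R + \<Lambda>\<^sub>1 * G + \<beta> * V"
    using flux_le[OF L2(1,3,4)] by (simp add: R_def G_def V_def)
  also have "\<dots> \<le> Q + \<Lambda>\<^sub>1 * (g * Q) + \<beta> * (K * Q)"
    using V G nn pos by (intro add_mono mult_left_mono) (auto simp: Q_def)
  finally have T: "L2_norm \<Omega> \<tau> \<le> (1 + \<Lambda>\<^sub>1 * g + \<beta> * K) * Q"
    by (simp add: algebra_simps)
  have "L2_norm \<Omega> (weak_div \<Omega> \<tau>) \<le> S + a\<^sub>1 * V"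
    using div_le[OF L2(2,3)] by (simp add: S_def V_def)
  also have "\<dots> \<le> Q + a\<^sub>1 * (K * Q)"
    using V nn pos by (intro add_mono mult_left_mono) (auto simp: Q_def)
  finally have D: "L2_norm \<Omega> (weak_div \<Omega> \<tau>) \<le> (1 + a\<^sub>1 * K) * Q"
    by (simp add: algebra_simps)
  have "(energy_norm \<Omega> A a (\<tau>, v))\<^sup>2 \<le> a\<^sub>1 * V\<^sup>2 + \<Lambda>\<^sub>1 * G\<^sup>2 + (1 / \<Lambda>\<^sub>0) * (L2_norm \<Omega> \<tau>)\<^sup>2 +
      (1 / a\<^sub>0) * (L2_norm \<Omega> (weak_div \<Omega> \<tau>))\<^sup>2"
    using energy_norm_sq_le[OF L2] by (simp add: V_def G_def)
  also have "\<dots> \<le> a\<^sub>1 * (K * Q)\<^sup>2 + \<Lambda>\<^sub>1 * (g * Q)\<^sup>2 + (1 / \<Lambda>\<^sub>0) * ((1 + \<Lambda>\<^sub>1 * g + \<beta> * K) * Q)\<^sup>2 +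
      (1 / a\<^sub>0) * ((1 + a\<^sub>1 * K) * Q)\<^sup>2"
    using V G T D nn pos by (intro add_mono mult_left_mono power_mono) auto
  also have "\<dots> = m * Q\<^sup>2"
    by (simp only: m_def power_mult_distrib distrib_right[of _ _ "Q\<^sup>2"] mult.assoc)
  also have "\<dots> \<le> m * (2 * (R\<^sup>2 + S\<^sup>2))"
    using sum_squares_bound[of R S] m by (intro mult_left_mono) (auto simp: Q_def power2_sum)
  also have "\<dots> \<le> m * (2 * ((\<Lambda>\<^sub>1 + a\<^sub>1) * ls_form \<Omega> A b a (\<tau>, v) (\<tau>, v)))"
  proof (intro mult_left_mono m)
    \<comment> \<open>The sum of \<open>\<Lambda>\<^sub>1\<close> and \<open>a\<^sub>1\<close>
      stands in for their maximum, at the price of nonnegative mixed terms.\<close>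
    have "R\<^sup>2 + S\<^sup>2 \<le> (\<Lambda>\<^sub>1 + a\<^sub>1) * ((1 / \<Lambda>\<^sub>1) * R\<^sup>2 + (1 / a\<^sub>1) * S\<^sup>2)"
    proof -
      have "0 \<le> a\<^sub>1 * R\<^sup>2 / \<Lambda>\<^sub>1 + \<Lambda>\<^sub>1 * S\<^sup>2 / a\<^sub>1" using pos by simp
      then show ?thesis using pos by (simp add: distrib_right distrib_left add_divide_distrib)
    qed
    also have "\<dots> \<le> (\<Lambda>\<^sub>1 + a\<^sub>1) * ls_form \<Omega> A b a (\<tau>, v) (\<tau>, v)"
      using ls_form_diag_ge[OF L2] pos by (intro mult_left_mono) (auto simp: R_def S_def)
    finally show "R\<^sup>2 + S\<^sup>2 \<le> (\<Lambda>\<^sub>1 + a\<^sub>1) * ls_form \<Omega> A b a (\<tau>, v) (\<tau>, v)" .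
  qed simp
  finally show ?thesis by (simp add: algebra_simps)
qed

lemma residuals_le_energy_norm:
  assumes "\<tau> \<in> L2 \<Omega>" "weak_div \<Omega> \<tau> \<in> L2 \<Omega>" "v \<in> L2 \<Omega>" "weak_grad \<Omega> v \<in> L2 \<Omega>"
  shows "L2_norm \<Omega> (flux_residual \<tau> v) \<le>
      (sqrt \<Lambda>\<^sub>1 + \<Lambda>\<^sub>1 * sqrt (1 / \<Lambda>\<^sub>0) + \<beta> * sqrt (1 / a\<^sub>0)) * energy_norm \<Omega> A a (\<tau>, v)"
    and "L2_norm \<Omega> (div_residual \<tau> v) \<le> (sqrt a\<^sub>1 + a\<^sub>1 * sqrt (1 / a\<^sub>0)) * energy_norm \<Omega> A a (\<tau>, v)"
proof -
  note le = L2_norms_le_energy_norm[OF assms]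
  have "\<Lambda>\<^sub>1 * L2_norm \<Omega> (weak_grad \<Omega> v) \<le> \<Lambda>\<^sub>1 * (sqrt (1 / \<Lambda>\<^sub>0) * energy_norm \<Omega> A a (\<tau>, v))"
    "\<beta> * L2_norm \<Omega> v \<le> \<beta> * (sqrt (1 / a\<^sub>0) * energy_norm \<Omega> A a (\<tau>, v))"
    "a\<^sub>1 * L2_norm \<Omega> v \<le> a\<^sub>1 * (sqrt (1 / a\<^sub>0) * energy_norm \<Omega> A a (\<tau>, v))"
    using le \<Lambda>\<^sub>1_pos \<beta>_nonneg a\<^sub>1_pos by (auto intro!: mult_left_mono simp del: real_sqrt_divide)
  then show "L2_norm \<Omega> (flux_residual \<tau> v) \<le>
      (sqrt \<Lambda>\<^sub>1 + \<Lambda>\<^sub>1 * sqrt (1 / \<Lambda>\<^sub>0) + \<beta> * sqrt (1 / a\<^sub>0)) * energy_norm \<Omega> A a (\<tau>, v)"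
    "L2_norm \<Omega> (div_residual \<tau> v) \<le> (sqrt a\<^sub>1 + a\<^sub>1 * sqrt (1 / a\<^sub>0)) * energy_norm \<Omega> A a (\<tau>, v)"
    using flux_residual_L2(2)[OF assms(1,3,4)] div_residual_L2(2)[OF assms(2,3)] le(3,4)
    unfolding distrib_right mult.assoc by linarith+
qed

text \<open>Each residual norm in \<open>ls_form_le\<close> is replaced by its energy bound;
  \<open>c\<close> and \<open>d\<close> are the constants of
  \<open>residuals_le_energy_norm\<close>.\<close>

lemma ls_form_continuous:
  assumes \<eta>: "\<eta> \<in> L2 \<Omega>" "weak_div \<Omega> \<eta> \<in> L2 \<Omega>" and w: "w \<in> L2 \<Omega>" "weak_grad \<Omega> w \<in> L2 \<Omega>"
    and \<tau>: "\<tau> \<in> L2 \<Omega>" "weak_div \<Omega> \<tau> \<in> L2 \<Omega>" and v: "v \<in> L2 \<Omega>" "weak_grad \<Omega> v \<in> L2 \<Omega>"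
  defines "c \<equiv> sqrt \<Lambda>\<^sub>1 + \<Lambda>\<^sub>1 * sqrt (1 / \<Lambda>\<^sub>0) + \<beta> * sqrt (1 / a\<^sub>0)"
    and "d \<equiv> sqrt a\<^sub>1 + a\<^sub>1 * sqrt (1 / a\<^sub>0)"
  shows "ls_form \<Omega> A b a (\<eta>, w) (\<tau>, v) \<le>
    ((1 / \<Lambda>\<^sub>0) * c\<^sup>2 + (1 / a\<^sub>0) * d\<^sup>2) * energy_norm \<Omega> A a (\<eta>, w) * energy_norm \<Omega> A a (\<tau>, v)"
proof -
  define E where "E = energy_norm \<Omega> A a (\<eta>, w)"
  define E' where "E' = energy_norm \<Omega> A a (\<tau>, v)"
  have nn: "0 \<le> E" "0 \<le> E'" "0 \<le> c" "0 \<le> d"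
    using \<Lambda>\<^sub>0_pos \<Lambda>\<^sub>1_pos a\<^sub>0_pos a\<^sub>1_pos \<beta>_nonneg by (auto simp: E_def E'_def c_def d_def)
  have "ls_form \<Omega> A b a (\<eta>, w) (\<tau>, v) \<le>
    (1 / \<Lambda>\<^sub>0) * (L2_norm \<Omega> (flux_residual \<eta> w) * L2_norm \<Omega> (flux_residual \<tau> v)) +
    (1 / a\<^sub>0) * (L2_norm \<Omega> (div_residual \<eta> w) * L2_norm \<Omega> (div_residual \<tau> v))"
    by (rule ls_form_le[OF \<eta> w \<tau> v])
  also have "\<dots> \<le> (1 / \<Lambda>\<^sub>0) * ((c * E) * (c * E')) + (1 / a\<^sub>0) * ((d * E) * (d * E'))"
    using residuals_le_energy_norm[OF \<eta> w] residuals_le_energy_norm[OF \<tau> v] nn \<Lambda>\<^sub>0_pos a\<^sub>0_pos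
    unfolding E_def[symmetric] E'_def[symmetric] c_def[symmetric] d_def[symmetric]
    by (intro add_mono mult_left_mono mult_mono) auto
  also have "\<dots> = ((1 / \<Lambda>\<^sub>0) * c\<^sup>2 + (1 / a\<^sub>0) * d\<^sup>2) * E * E'"
    by (simp add: power2_eq_square algebra_simps)
  finally show ?thesis by (simp only: E_def E'_def)
qed

end

text \<open>Ellipticity is given almost everywhere on the closure and passes to the open set
  contained in it.\<close>

lemma admissible_coeffs_imp_elliptic_coeffs:
  fixes \<Omega> :: "(real^'n) set"
  assumes coeffs: "admissible_coeffs \<Omega> \<Lambda>\<^sub>0 \<Lambda>\<^sub>1 \<beta> a\<^sub>0 a\<^sub>1 A b a" and \<Omega>: "open \<Omega>"
    and "0 < \<Lambda>\<^sub>0" "\<Lambda>\<^sub>0 \<le> \<Lambda>\<^sub>1" "0 \<le> \<beta>" "0 < a\<^sub>0" "a\<^sub>0 \<le> a\<^sub>1"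
  shows "elliptic_coeffs \<Omega> \<Lambda>\<^sub>0 \<Lambda>\<^sub>1 \<beta> a\<^sub>0 a\<^sub>1 A b a"
proof
  have sets: "\<Omega> \<in> sets lebesgue" "closure \<Omega> \<in> sets lebesgue"
    using \<Omega> by auto
  show "\<Omega> \<in> sets lebesgue" by fact
  have "AE x in lebesgue_on (closure \<Omega>). spd_matrix (A x) \<Lambda>\<^sub>0 \<Lambda>\<^sub>1"
    using coeffs \<open>0 < \<Lambda>\<^sub>0\<close>
    by (auto simp: admissible_coeffs_def spd_matrix_def elim!: eventually_elim2)
  then show "AE x in lebesgue_on \<Omega>. spd_matrix (A x) \<Lambda>\<^sub>0 \<Lambda>\<^sub>1"
    using sets closure_subset[of \<Omega>] by (auto simp: AE_restrict_space_iff elim!: eventually_mono)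
qed (use assms in \<open>auto simp: admissible_coeffs_def\<close>)

theorem theorem2p3:
  fixes \<Omega> \<Gamma>\<^sub>D \<Gamma>\<^sub>N :: "(real^'n) set"
    and \<Lambda>\<^sub>0 \<Lambda>\<^sub>1 \<beta> a\<^sub>0 a\<^sub>1 K :: real
  assumes "CARD('n) = 2 \<or> CARD('n) = 3"
    and "admissible_domain \<Omega> \<Gamma>\<^sub>D \<Gamma>\<^sub>N"
    and "0 < \<Lambda>\<^sub>0" and "\<Lambda>\<^sub>0 \<le> \<Lambda>\<^sub>1"
    and "0 \<le> \<beta>"
    and "0 < a\<^sub>0" and "a\<^sub>0 \<le> a\<^sub>1"
    and "0 < K"
  shows "\<exists>\<alpha>>0. \<exists>C>0. \<forall>A b a.
           admissible_coeffs \<Omega> \<Lambda>\<^sub>0 \<Lambda>\<^sub>1 \<beta> a\<^sub>0 a\<^sub>1 A b a \<longrightarrow> H2_regular \<Omega> \<Gamma>\<^sub>D A b a K \<longrightarrow>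
           (\<forall>\<tau>\<in>H_N_div \<Omega> \<Gamma>\<^sub>D. \<forall>v\<in>H1_D \<Omega> \<Gamma>\<^sub>D.
              \<alpha> * (energy_norm \<Omega> A a (\<tau>, v))\<^sup>2 \<le> ls_form \<Omega> A b a (\<tau>, v) (\<tau>, v)) \<and>
           (\<forall>\<eta>\<in>H_N_div \<Omega> \<Gamma>\<^sub>D. \<forall>w\<in>H1_D \<Omega> \<Gamma>\<^sub>D. \<forall>\<tau>\<in>H_N_div \<Omega> \<Gamma>\<^sub>D. \<forall>v\<in>H1_D \<Omega> \<Gamma>\<^sub>D.
              ls_form \<Omega> A b a (\<eta>, w) (\<tau>, v)
                \<le> C * energy_norm \<Omega> A a (\<eta>, w) * energy_norm \<Omega> A a (\<tau>, v))"
proof -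
  \<comment> \<open>The constants repeat those of the coercivity and continuity estimates. They
    involve only the bounds and \<open>K\<close>, so they can be fixed before the coefficients are
    introduced.\<close>
  define g where "g = 1 + (\<beta> * K + 1 + K) / \<Lambda>\<^sub>0"
  define m where "m = a\<^sub>1 * K\<^sup>2 + \<Lambda>\<^sub>1 * g\<^sup>2 + (1 / \<Lambda>\<^sub>0) * (1 + \<Lambda>\<^sub>1 * g + \<beta> * K)\<^sup>2 + (1 / a\<^sub>0) * (1 + a\<^sub>1 * K)\<^sup>2"
  define M where "M = 2 * m * (\<Lambda>\<^sub>1 + a\<^sub>1)"
  define c where "c = sqrt \<Lambda>\<^sub>1 + \<Lambda>\<^sub>1 * sqrt (1 / \<Lambda>\<^sub>0) + \<beta> * sqrt (1 / a\<^sub>0)"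
  define d where "d = sqrt a\<^sub>1 + a\<^sub>1 * sqrt (1 / a\<^sub>0)"
  define C where "C = (1 / \<Lambda>\<^sub>0) * c\<^sup>2 + (1 / a\<^sub>0) * d\<^sup>2"
  have pos: "0 < \<Lambda>\<^sub>1" "0 < a\<^sub>1" using assms by linarith+
  have "0 < m"
    unfolding m_def using assms pos by (intro add_nonneg_pos add_pos_nonneg mult_pos_pos) auto
  then have M: "0 < M" using pos by (simp add: M_def)
  have "0 < d" unfolding d_def using assms pos by (intro add_pos_pos mult_pos_pos) auto
  then have C: "0 < C" unfolding C_def using assms by (intro add_nonneg_pos) auto
  have \<Omega>: "open \<Omega>" using assms(2) by (simp add: admissible_domain_def)
  show ?thesis
  proof (rule exI[of _ "1 / M"], rule conjI, use M in simp,
      rule exI[of _ C], intro conjI allI impI ballI)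
    show "0 < C" by (fact C)
  next
    fix A b a \<tau> v
    assume coeffs: "admissible_coeffs \<Omega> \<Lambda>\<^sub>0 \<Lambda>\<^sub>1 \<beta> a\<^sub>0 a\<^sub>1 A b a" and reg: "H2_regular \<Omega> \<Gamma>\<^sub>D A b a K"
      and \<tau>: "\<tau> \<in> H_N_div \<Omega> \<Gamma>\<^sub>D" and v: "v \<in> H1_D \<Omega> \<Gamma>\<^sub>D"
    interpret elliptic_coeffs \<Omega> \<Lambda>\<^sub>0 \<Lambda>\<^sub>1 \<beta> a\<^sub>0 a\<^sub>1 A b a
      by (rule admissible_coeffs_imp_elliptic_coeffs[OF coeffs \<Omega> assms(3-7)])
    \<comment> \<open>The regularity assumption is applied with \<open>v\<close> itself as
      right-hand side, which supplies the solution for the duality argument.\<close>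
    obtain u where u: "primal_solution \<Omega> \<Gamma>\<^sub>D A b a v u" "H2_norm \<Omega> u \<le> K * L2_norm \<Omega> v"
      using reg H1_D_L2(1)[OF v] unfolding H2_regular_def by blast
    have "(energy_norm \<Omega> A a (\<tau>, v))\<^sup>2 \<le> M * ls_form \<Omega> A b a (\<tau>, v) (\<tau>, v)"
      unfolding M_def m_def g_def using ls_form_coercive[OF \<tau> v u] assms(8) by simp
    then show "1 / M * (energy_norm \<Omega> A a (\<tau>, v))\<^sup>2 \<le> ls_form \<Omega> A b a (\<tau>, v) (\<tau>, v)"
      using M by (simp add: field_simps)
  next
    fix A b a \<eta> w \<tau> v
    assume coeffs: "admissible_coeffs \<Omega> \<Lambda>\<^sub>0 \<Lambda>\<^sub>1 \<beta> a\<^sub>0 a\<^sub>1 A b a"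
      and L2: "\<eta> \<in> H_N_div \<Omega> \<Gamma>\<^sub>D" "w \<in> H1_D \<Omega> \<Gamma>\<^sub>D" "\<tau> \<in> H_N_div \<Omega> \<Gamma>\<^sub>D" "v \<in> H1_D \<Omega> \<Gamma>\<^sub>D"
    interpret elliptic_coeffs \<Omega> \<Lambda>\<^sub>0 \<Lambda>\<^sub>1 \<beta> a\<^sub>0 a\<^sub>1 A b a
      by (rule admissible_coeffs_imp_elliptic_coeffs[OF coeffs \<Omega> assms(3-7)])
    show "ls_form \<Omega> A b a (\<eta>, w) (\<tau>, v)
        \<le> C * energy_norm \<Omega> A a (\<eta>, w) * energy_norm \<Omega> A a (\<tau>, v)"
      unfolding C_def c_def d_def
      by (intro ls_form_continuous H_N_div_L2[OF L2(1)] H1_D_L2[OF L2(2)] H_N_div_L2[OF L2(3)]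
          H1_D_L2[OF L2(4)])
  qed
qed

end
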